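(* There exist absolute constants $a_0,a_1>0$ such that the following holds for every convex body $K\subset[0,1]^2$, every $N\in\mathbb{N}_0$ and every integer $m\ge 3$. Let $\hat P_m$ be a least squares estimator of $K$ on the space $\mathcal{P}^{(m)}$ with respect to the first $(N+1)^2$ geometric moments, and let $\hat Q_m$ be a least squares estimator of $K$ on the space $\mathcal{P}^{(m)}$ with respect to the first $(N+1)^2$ Legendre moments. Then \[\delta_N(\hat P_m,K)\le a_0(n+1)^2e^{7(n+1)}\left(1+\tfrac12\ln(2n+1)\right)^2\frac{8\pi^3+16\pi}{m^2}+\frac{a_1}{n+1}\] for $n=0,\dots,N$, and \[\delta_N(\hat Q_m,K)\le\frac{8\pi^3+16\pi}{m^2}+\frac{a_1}{N+1}.\]
   Context: A convex body is a compact, convex subset of $\mathbb{R}^2$ with nonempty interior. For compact $K\subset[0,1]^2$ and $i,j\in\mathbb{N}_0$, the geometric moments are $\mu_{ij}(K)=\int_K x_1^ix_2^j\,d(x_1,x_2)$ and the Legendre moments are $\lambda_{ij}(K)=\int_K L_i(x_1)L_j(x_2)\,d(x_1,x_2)$, where $L_i:[0,1]\to\mathbb{R}$, $i\in\mathbb{N}_0$, are the shifted normalized Legendre polynomials, obtained by Gram-Schmidt orthonormalization of $1,x,x^2,\dots$ in $L^2([0,1])$. $\mathcal{P}^{(m)}$ is the set of convex polygons contained in $[0,1]^2$ with at most $m$ vertices (degenerate polygons with empty interior are allowed). A least squares estimator of $K$ on $\mathcal{P}^{(m)}$ with respect to the first $(N+1)^2$ geometric (respectively Legendre) moments is any $P\in\mathcal{P}^{(m)}$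 minimizing $\sum_{i,j=0}^N(\mu_{ij}(K)-\mu_{ij}(P))^2$ (respectively $\sum_{i,j=0}^N(\lambda_{ij}(K)-\lambda_{ij}(P))^2$) over $\mathcal{P}^{(m)}$. For compact convex $K,L\subset[0,1]^2$, $\delta_N(K,L)$ is the area of the symmetric difference $(K\setminus L)\cup(L\setminus K)$ (the subscript in $\delta_N$ stands for Nikodym and is unrelated to the integer $N$). *)

theory Defs
  imports "HOL-Analysis.Analysis"
begin

abbreviation unit_square :: "(real^2) set" where
  "unit_square \<equiv> cbox 0 1"

definition convex_body :: "(real^2) set \<Rightarrow> bool" where
  "convex_body K \<longleftrightarrow> compact K \<and> convex K \<and> interior K \<noteq> {}"

definition L2_inner :: "real poly \<Rightarrow> real poly \<Rightarrow> real" where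
  "L2_inner p q = (LINT x:{0..1}|lborel. poly p x * poly q x)"

text \<open>Shifted normalized Legendre polynomials on $[0,1]$: Gram-Schmidt orthonormalization of
  $1, x, x^2, \ldots$ in $L^2([0,1])$.\<close>

fun legendre :: "nat \<Rightarrow> real poly" where
  "legendre n =
    (let q = monom 1 n - (\<Sum>k<n. smult (L2_inner (monom 1 n) (legendre k)) (legendre k))
     in smult (1 / sqrt (L2_inner q q)) q)"

declare legendre.simps [simp del]

definition geometric_moment :: "nat \<Rightarrow> nat \<Rightarrow> (real^2) set \<Rightarrow> real" where
  "geometric_moment i j K = (LINT x:K|lborel. (x $ 1) ^ i * (x $ 2) ^ j)"

definition legendre_moment :: "nat \<Rightarrow> nat \<Rightarrow> (real^2) set \<Rightarrow> real" where
  "legendre_moment i j K =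
    (LINT x:K|lborel. poly (legendre i) (x $ 1) * poly (legendre j) (x $ 2))"

text \<open>Polytopes of any dimension are admitted, so points and segments count as (degenerate)
  polygons. The library's \<^const>\<open>polytope\<close> also admits the empty set, which is excluded here.\<close>

definition convex_polygons :: "nat \<Rightarrow> (real^2) set set" where
  "convex_polygons m =
    {P. polytope P \<and> P \<noteq> {} \<and> P \<subseteq> unit_square \<and> card {v. v extreme_point_of P} \<le> m}"

definition least_squares_estimator ::
  "(nat \<Rightarrow> nat \<Rightarrow> (real^2) set \<Rightarrow> real) \<Rightarrow> nat \<Rightarrow> nat \<Rightarrow> (real^2) set \<Rightarrow> (real^2) set \<Rightarrow> bool" where
  "least_squares_estimator moment N m K P \<longleftrightarrow>
    is_arg_min (\<lambda>Q. \<Sum>i\<le>N. \<Sum>j\<le>N. (moment i j K - moment i j Q)\<^sup>2)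
      (\<lambda>Q. Q \<in> convex_polygons m) P"

definition nikodym_dist :: "(real^2) set \<Rightarrow> (real^2) set \<Rightarrow> real" where
  "nikodym_dist K L = measure lborel ((K - L) \<union> (L - K))"

end

theory Submission
  imports Defs
begin

text \<open>Since \<open>1\<^sub>K - 1\<^sub>P\<close> takes only the values \<open>-1, 0, 1\<close>, the Nikodym distance of \<open>K\<close> and \<open>P\<close> is
  its squared \<open>L\<^sup>2\<close> norm, which by Parseval is the sum of the squared differences of the Legendre
  moments up to degree \<open>N\<close> plus a tail. Slices of convex sets are intervals, and a step function
  is approximated by polynomials of degree \<open>N\<close> with squared \<open>L\<^sup>2\<close> error \<open>O(1/N)\<close> (in the variable
  \<open>- cos t\<close> it becomes a square wave, and one truncates its Fourier series), so the tail is
  \<open>O(1/N)\<close>. The moment part is at most that of a competitor \<open>A\<close> inscribed in \<open>K\<close>, which is the area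
  of \<open>K - A\<close> in the Legendre case by Bessel's inequality, and a constant multiple of it in the
  geometric case by boundedness of the Hilbert matrix.

  To pass from geometric to Legendre moments one only needs the coefficients of the Legendre
  polynomials to grow at most exponentially: working with degree \<open>n div 4\<close> instead of \<open>n\<close> makes
  \<open>exp (7 * (n + 1))\<close> large enough and costs a factor 4 in the constant \<open>a1\<close>. (With degree \<open>n\<close>
  itself, \<open>exp (7 * n)\<close> is too small: the smallest eigenvalue of the Hilbert matrix forces a
  growth of \<open>(1 + sqrt 2) ^ (8 * n)\<close>.)\<close>

section \<open>Orthonormal systems\<close>

text \<open>The estimator is an unknown polygon, so the tail must be bounded for all pairs of convex
  sets at once; hence only the fact that slices are intervals enters there. The rate 1/N for a
  squared \<open>L\<^sup>2\<close> error is enough because the Nikodym distance is itself a squared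
  norm, so no square root is ever taken. The two changes of basis are asymmetric: bounding geometric
  moments by the norm costs a factor 16, independent of the degree, whereas recovering Legendre
  moments from geometric ones costs an exponential, since high powers are nearly linearly dependent.
  The competitor has to meet the constant \<open>8 * pi ^ 3 + 16 * pi\<close> itself, because the
  Legendre bound has no absolute factor in front of it. Averaging over shifted nodes gives an area
  deficit of \<open>18 * pi\<^sup>2 / m\<^sup>2\<close> for m > 16, which is smaller; for m \<le> 16
  the bound already exceeds the area of the unit square.\<close>

definition sq_int :: "'a measure \<Rightarrow> ('a \<Rightarrow> real) \<Rightarrow> bool" where
  "sq_int M f \<longleftrightarrow> f \<in> borel_measurable M \<and> integrable M (\<lambda>x. (f x)\<^sup>2)"

lemma sq_int_mult_integrable:
  assumes "sq_int M f" "sq_int M g"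
  shows "integrable M (\<lambda>x. f x * g x)"
proof (rule Bochner_Integration.integrable_bound)
  show "integrable M (\<lambda>x. (f x)\<^sup>2 + (g x)\<^sup>2)"
    using assms by (simp add: sq_int_def)
  show "(\<lambda>x. f x * g x) \<in> borel_measurable M"
    using assms by (auto simp: sq_int_def)
  have "\<bar>a * b\<bar> \<le> a\<^sup>2 + b\<^sup>2" for a b :: real
  proof -
    have "2 * \<bar>a\<bar> * \<bar>b\<bar> \<le> \<bar>a\<bar>\<^sup>2 + \<bar>b\<bar>\<^sup>2" by (rule sum_squares_bound)
    moreover have "0 \<le> \<bar>a\<bar> * \<bar>b\<bar>" by simp
    ultimately have "\<bar>a\<bar> * \<bar>b\<bar> \<le> a\<^sup>2 + b\<^sup>2" unfolding power2_abs by linarith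
    then show ?thesis by (simp add: abs_mult)
  qed
  then show "AE x in M. norm (f x * g x) \<le> norm ((f x)\<^sup>2 + (g x)\<^sup>2)"
    by auto
qed

lemma sq_int_scale: "sq_int M f \<Longrightarrow> sq_int M (\<lambda>x. c * f x)"
  by (auto simp: sq_int_def power_mult_distrib)

lemma sq_int_add:
  assumes "sq_int M f" "sq_int M g" shows "sq_int M (\<lambda>x. f x + g x)"
proof -
  have "integrable M (\<lambda>x. (f x)\<^sup>2 + (g x)\<^sup>2 + 2 * (f x * g x))"
    using assms sq_int_mult_integrable[OF assms] by (simp add: sq_int_def)
  then show ?thesis
    using assms by (auto simp: sq_int_def power2_sum mult.assoc)
qed

lemma sq_int_diff:
  assumes "sq_int M f" "sq_int M g" shows "sq_int M (\<lambda>x. f x - g x)"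
  using sq_int_add[OF assms(1) sq_int_scale[OF assms(2), of "-1"]] by simp

lemma sq_int_sum:
  assumes "\<And>i. i \<in> I \<Longrightarrow> sq_int M (f i)"
  shows "sq_int M (\<lambda>x. \<Sum>i\<in>I. f i x)"
  using assms
proof (induction I rule: infinite_finite_induct)
  case (insert i I)
  then show ?case using sq_int_add[of M "f i" "\<lambda>x. \<Sum>i\<in>I. f i x"] by simp
qed (simp_all add: sq_int_def)

lemma (in finite_measure) sq_int_bounded:
  assumes "f \<in> borel_measurable M" "AE x in M. \<bar>f x\<bar> \<le> B"
  shows "sq_int M f"
  unfolding sq_int_def
proof
  show "integrable M (\<lambda>x. (f x)\<^sup>2)"
  proof (rule integrable_const_bound)
    show "AE x in M. norm ((f x)\<^sup>2) \<le> B\<^sup>2"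
      using assms(2) by eventually_elim (metis abs_ge_zero norm_power power_mono real_norm_def)
  qed (use assms(1) in auto)
qed fact

text \<open>Stated for arbitrary \<open>c\<close>: the Fourier coefficients make the last sum vanish
  and give the exact remainder, hence Bessel's inequality; any other choice shows that this
  remainder is the least possible error.\<close>

lemma orthonormal_dist_squared:
  assumes I: "finite I" and phi: "\<And>i. i \<in> I \<Longrightarrow> sq_int M (\<phi> i)" and f: "sq_int M f"
    and on: "\<And>i j. i \<in> I \<Longrightarrow> j \<in> I \<Longrightarrow> (\<integral>x. \<phi> i x * \<phi> j x \<partial>M) = (if i = j then 1 else 0)"
  shows "(\<integral>x. (f x - (\<Sum>i\<in>I. c i * \<phi> i x))\<^sup>2 \<partial>M) =
    (\<integral>x. (f x)\<^sup>2 \<partial>M) - (\<Sum>i\<in>I. (\<integral>x. f x * \<phi> i x \<partial>M)\<^sup>2) +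
    (\<Sum>i\<in>I. (c i - (\<integral>x. f x * \<phi> i x \<partial>M))\<^sup>2)"
proof -
  let ?b = "\<lambda>i. \<integral>x. f x * \<phi> i x \<partial>M"
  have expand: "(f x - (\<Sum>i\<in>I. c i * \<phi> i x))\<^sup>2 =
    (f x)\<^sup>2 - (\<Sum>i\<in>I. 2 * c i * (f x * \<phi> i x)) + (\<Sum>i\<in>I. \<Sum>j\<in>I. c i * c j * (\<phi> i x * \<phi> j x))" for x
  proof -
    have "(\<Sum>i\<in>I. c i * \<phi> i x)\<^sup>2 = (\<Sum>i\<in>I. \<Sum>j\<in>I. c i * c j * (\<phi> i x * \<phi> j x))"
      by (simp add: power2_eq_square sum_product algebra_simps)
    moreover have "2 * f x * (\<Sum>i\<in>I. c i * \<phi> i x) = (\<Sum>i\<in>I. 2 * c i * (f x * \<phi> i x))"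
      by (simp add: sum_distrib_left algebra_simps)
    ultimately show ?thesis by (simp add: power2_diff)
  qed
  have [simp]: "integrable M (\<lambda>x. (f x)\<^sup>2)" using f by (simp add: sq_int_def)
  have [simp]: "i \<in> I \<Longrightarrow> integrable M (\<lambda>x. f x * \<phi> i x)" for i
    by (intro sq_int_mult_integrable f phi)
  have [simp]: "i \<in> I \<Longrightarrow> j \<in> I \<Longrightarrow> integrable M (\<lambda>x. \<phi> i x * \<phi> j x)" for i j
    by (intro sq_int_mult_integrable phi)
  have "(\<integral>x. (f x - (\<Sum>i\<in>I. c i * \<phi> i x))\<^sup>2 \<partial>M) =
    (\<integral>x. (f x)\<^sup>2 \<partial>M) - (\<Sum>i\<in>I. 2 * c i * ?b i) +
    (\<Sum>i\<in>I. \<Sum>j\<in>I. c i * c j * (\<integral>x. \<phi> i x * \<phi> j x \<partial>M))"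
    unfolding expand by (subst Bochner_Integration.integral_add Bochner_Integration.integral_diff
        Bochner_Integration.integral_sum; (auto intro!: Bochner_Integration.integrable_sum
          Bochner_Integration.integrable_diff)?)+
  also have "(\<Sum>i\<in>I. \<Sum>j\<in>I. c i * c j * (\<integral>x. \<phi> i x * \<phi> j x \<partial>M)) = (\<Sum>i\<in>I. (c i)\<^sup>2)"
  proof (rule sum.cong)
    fix i assume "i \<in> I"
    have "(\<Sum>j\<in>I. c i * c j * (\<integral>x. \<phi> i x * \<phi> j x \<partial>M)) = (\<Sum>j\<in>I. if i = j then (c i)\<^sup>2 else 0)"
      using \<open>i \<in> I\<close> by (intro sum.cong) (auto simp: on power2_eq_square)
    then show "(\<Sum>j\<in>I. c i * c j * (\<integral>x. \<phi> i x * \<phi> j x \<partial>M)) = (c i)\<^sup>2"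
      using I \<open>i \<in> I\<close> by simp
  qed simp
  finally show ?thesis
    by (simp add: power2_diff sum.distrib sum_subtractf sum_distrib_left algebra_simps)
qed

corollary bessel_inequality:
  assumes "finite I" "\<And>i. i \<in> I \<Longrightarrow> sq_int M (\<phi> i)" "sq_int M f"
    "\<And>i j. i \<in> I \<Longrightarrow> j \<in> I \<Longrightarrow> (\<integral>x. \<phi> i x * \<phi> j x \<partial>M) = (if i = j then 1 else 0)"
  shows "(\<Sum>i\<in>I. (\<integral>x. f x * \<phi> i x \<partial>M)\<^sup>2) \<le> (\<integral>x. (f x)\<^sup>2 \<partial>M)"
proof -
  have "0 \<le> (\<integral>x. (f x - (\<Sum>i\<in>I. (\<integral>x. f x * \<phi> i x \<partial>M) * \<phi> i x))\<^sup>2 \<partial>M)"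
    by (rule integral_nonneg_AE) simp
  then show ?thesis
    using orthonormal_dist_squared[OF assms, where c = "\<lambda>i. \<integral>x. f x * \<phi> i x \<partial>M"] by simp
qed

section \<open>Legendre polynomials\<close>

text \<open>Lebesgue measure on [0,1], carried by all of the real line through a density: integrands
  need no restricted domain, and the interval reappears only in almost-everywhere
  statements.\<close>

definition unif :: "real measure" where
  "unif = density lborel (indicator {0..1})"

lemma space_unif [simp]: "space unif = UNIV" and sets_unif [simp, measurable_cong]: "sets unif = sets borel"
  by (auto simp: unif_def)

lemma emeasure_unif_UNIV: "emeasure unif UNIV = 1"
  by (simp add: unif_def emeasure_density)

interpretation unif: finite_measure unif
  by standard (simp add: emeasure_unif_UNIV)

lemma AE_unif: "(AE x in unif. P x) \<longleftrightarrow> (AE x in lborel. x \<in> {0..1} \<longrightarrow> P x)"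
  unfolding unif_def by (subst AE_density) (auto simp: indicator_def)

lemma AE_unifI: "(\<And>x. 0 \<le> x \<Longrightarrow> x \<le> 1 \<Longrightarrow> P x) \<Longrightarrow> AE x in unif. P x"
  by (subst AE_unif) (rule AE_I2, auto)

lemma integral_unif:
  fixes f :: "real \<Rightarrow> real"
  shows "f \<in> borel_measurable borel \<Longrightarrow> (\<integral>x. f x \<partial>unif) = (LINT x:{0..1}|lborel. f x)"
  unfolding unif_def set_lebesgue_integral_def
  using integral_density[of f lborel "indicator {0..1}"] by (simp add: ennreal_indicator[abs_def])

lemma borel_measurable_poly [measurable]: "poly (p :: real poly) \<in> borel_measurable borel"
  by (intro borel_measurable_continuous_onI continuous_on_poly continuous_on_id)

lemma poly_bounded_unit: "\<exists>B. \<forall>x. 0 \<le> x \<longrightarrow> x \<le> 1 \<longrightarrow> \<bar>poly (p :: real poly) x\<bar> \<le> B"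
proof -
  have "compact (poly p ` {0..1})"
    by (intro compact_continuous_image continuous_on_poly continuous_on_id) auto
  then have "bounded (poly p ` {0..1})" by (rule compact_imp_bounded)
  then show ?thesis unfolding bounded_real by force
qed

lemma sq_int_poly: "sq_int unif (poly p)"
proof -
  obtain B where "\<forall>x. 0 \<le> x \<longrightarrow> x \<le> 1 \<longrightarrow> \<bar>poly p x\<bar> \<le> B" using poly_bounded_unit by blast
  then show ?thesis by (intro unif.sq_int_bounded[of _ B] AE_unifI) auto
qed

lemma L2_inner_unif: "L2_inner p q = (\<integral>x. poly p x * poly q x \<partial>unif)"
  unfolding L2_inner_def by (subst integral_unif) auto

lemma integrable_poly_mult: "integrable unif (\<lambda>x. poly p x * poly q x)"
  by (intro sq_int_mult_integrable sq_int_poly)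

lemma L2_inner_commute: "L2_inner p q = L2_inner q p"
  by (simp add: L2_inner_def mult.commute)

lemma L2_inner_diff_left: "L2_inner (p - q) r = L2_inner p r - L2_inner q r"
  by (simp add: L2_inner_unif left_diff_distrib integrable_poly_mult)

lemma L2_inner_smult_left: "L2_inner (smult c p) r = c * L2_inner p r"
  by (simp add: L2_inner_unif mult.assoc)

lemma L2_inner_sum_left: "L2_inner (\<Sum>i\<in>I. p i) r = (\<Sum>i\<in>I. L2_inner (p i) r)"
  by (simp add: L2_inner_unif poly_sum sum_distrib_right integrable_poly_mult)

text \<open>If the integral vanished, \<open>p\<close> would be zero almost everywhere on [0,1], but
  its roots form a finite set, which is null. This makes the division in Gram-Schmidt
  meaningful.\<close>

lemma L2_inner_self_pos:
  assumes "p \<noteq> 0" shows "L2_inner p p > 0"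
proof -
  have nn: "L2_inner p p \<ge> 0"
    unfolding L2_inner_unif by (rule integral_nonneg_AE) simp
  have "L2_inner p p \<noteq> 0"
  proof
    assume "L2_inner p p = 0"
    then have "AE x in unif. poly p x * poly p x = 0"
      unfolding L2_inner_unif using integrable_poly_mult[of p p]
      by (subst integral_nonneg_eq_0_iff_AE[symmetric]) auto
    then have "AE x in lborel. x \<in> {0..1} \<longrightarrow> poly p x = 0"
      by (simp add: AE_unif)
    moreover have "AE x in lborel. x \<notin> {x. poly p x = 0}"
      by (intro AE_not_in finite_imp_null_set_lborel poly_roots_finite assms)
    ultimately have "AE x in lborel. (x :: real) \<notin> {0..1}"
      by eventually_elim auto
    then have "{0..1 :: real} \<in> null_sets lborel"
      by (subst (asm) AE_iff_null_sets[symmetric]) auto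
    then show False by (simp add: null_sets_def)
  qed
  with nn show ?thesis by simp
qed

text \<open>One induction for both facts. The degrees of the earlier polynomials show that
  subtracting the projections keeps the leading coefficient 1, so \<open>q\<close> is nonzero and
  can be normalized; their orthonormality makes \<open>q\<close> orthogonal to them.\<close>

lemma degree_legendre: "degree (legendre n) = n"
  and L2_inner_legendre: "m \<le> n \<Longrightarrow> L2_inner (legendre n) (legendre m) = (if m = n then 1 else 0)"
proof -
  have "degree (legendre n) = n \<and> (\<forall>m\<le>n. L2_inner (legendre n) (legendre m) = (if m = n then 1 else 0))"
  proof (induction n rule: less_induct)
    case (less n)
    define s where "s = (\<Sum>k<n. smult (L2_inner (monom 1 n) (legendre k)) (legendre k))"
    define q where "q = monom 1 n - s"
    have L: "legendre n = smult (1 / sqrt (L2_inner q q)) q"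
      by (subst legendre.simps) (simp add: Let_def q_def s_def)
    have "coeff s n = 0"
      unfolding s_def coeff_sum using less by (intro sum.neutral) (auto intro: coeff_eq_0)
    then have cq: "coeff q n = 1" by (simp add: q_def)
    moreover have "degree q \<le> n"
    proof -
      have "degree s \<le> n"
        unfolding s_def using less by (intro degree_sum_le) (auto intro: order_trans[OF degree_smult_le])
      then show ?thesis unfolding q_def by (intro degree_diff_le degree_monom_le)
    qed
    ultimately have dq: "degree q = n" by (intro antisym le_degree) auto
    have "q \<noteq> 0" using cq by auto
    then have pos: "L2_inner q q > 0" by (rule L2_inner_self_pos)
    have deg: "degree (legendre n) = n" using pos dq by (simp add: L)
    have orth: "L2_inner q (legendre m) = 0" if "m < n" for m
    proof -
      have "L2_inner s (legendre m) =
          (\<Sum>k<n. L2_inner (monom 1 n) (legendre k) * L2_inner (legendre k) (legendre m))"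
        by (simp add: s_def L2_inner_sum_left L2_inner_smult_left)
      also have "\<dots> = (\<Sum>k<n. if k = m then L2_inner (monom 1 n) (legendre m) else 0)"
      proof (intro sum.cong refl)
        fix k assume "k \<in> {..<n}"
        then have "L2_inner (legendre k) (legendre m) = (if k = m then 1 else 0)"
          using less that by (metis L2_inner_commute lessThan_iff nle_le)
        then show "L2_inner (monom 1 n) (legendre k) * L2_inner (legendre k) (legendre m) =
          (if k = m then L2_inner (monom 1 n) (legendre m) else 0)" by simp
      qed
      also have "\<dots> = L2_inner (monom 1 n) (legendre m)" using that by simp
      finally show ?thesis by (simp add: q_def L2_inner_diff_left)
    qed
    have "L2_inner (legendre n) (legendre m) = (if m = n then 1 else 0)" if "m \<le> n" for m
    proof (cases "m = n")
      case True
      have "L2_inner (legendre n) (legendre n) =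
          1 / sqrt (L2_inner q q) * (1 / sqrt (L2_inner q q) * L2_inner q q)"
        by (metis L L2_inner_commute L2_inner_smult_left)
      also have "\<dots> = 1" using pos by (simp add: real_div_sqrt divide_simps)
      finally show ?thesis using True by simp
    next
      case False
      then show ?thesis using that orth by (subst L) (simp add: L2_inner_smult_left)
    qed
    with deg show ?case by simp
  qed
  then show "degree (legendre n) = n"
    "m \<le> n \<Longrightarrow> L2_inner (legendre n) (legendre m) = (if m = n then 1 else 0)" by auto
qed

lemma legendre_orthonormal:
  "(\<integral>x. poly (legendre i) x * poly (legendre j) x \<partial>unif) = (if i = j then 1 else 0)"
  using L2_inner_legendre[of i j] L2_inner_legendre[of j i]
  by (cases "i \<le> j") (auto simp: L2_inner_unif mult.commute)

text \<open>Subtracting a multiple of \<open>legendre (Suc N)\<close>, whose degree is exactly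
  \<open>Suc N\<close>, cancels the leading coefficient.\<close>

lemma legendre_span:
  assumes "degree p \<le> N"
  shows "\<exists>c. p = (\<Sum>i\<le>N. smult (c i) (legendre i))"
  using assms
proof (induction N arbitrary: p)
  case 0
  then obtain a where p: "p = [:a:]" by (metis degree_eq_zeroE le_zero_eq)
  obtain b where b: "legendre 0 = [:b:]" by (metis degree_eq_zeroE degree_legendre)
  have "b \<noteq> 0" using L2_inner_legendre[of 0 0] b by (auto simp: L2_inner_def)
  then have "p = smult (a / b) (legendre 0)" by (simp add: p b)
  then show ?case by auto
next
  case (Suc N)
  let ?l = "coeff (legendre (Suc N)) (Suc N)"
  have l: "?l \<noteq> 0"
    by (metis degree_legendre degree_0 leading_coeff_0_iff nat.distinct(1))
  let ?c = "coeff p (Suc N) / ?l"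
  let ?r = "p - smult ?c (legendre (Suc N))"
  have "degree ?r \<le> N"
  proof (rule degree_le, clarify)
    fix i assume "N < i"
    then consider "i = Suc N" | "i > Suc N" by linarith
    then show "coeff ?r i = 0"
    proof cases
      case 2
      then show ?thesis using Suc.prems by (simp add: coeff_eq_0 degree_legendre)
    qed (use l in simp)
  qed
  then obtain c where c: "?r = (\<Sum>i\<le>N. smult (c i) (legendre i))" using Suc.IH by blast
  have "p = (\<Sum>i\<le>N. smult (c i) (legendre i)) + smult ?c (legendre (Suc N))"
    unfolding c[symmetric] by simp
  also have "\<dots> = (\<Sum>i\<le>Suc N. smult ((c(Suc N := ?c)) i) (legendre i))"
    by simp
  finally show ?case by blast
qed

text \<open>The tail is the squared distance of \<open>f\<close> from the polynomials of degree at
  most N, so any one of them bounds it from above.\<close>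

lemma legendre_tail_le:
  assumes "sq_int unif f" "degree p \<le> N"
  shows "(\<integral>x. (f x)\<^sup>2 \<partial>unif) - (\<Sum>i\<le>N. (\<integral>x. f x * poly (legendre i) x \<partial>unif)\<^sup>2)
    \<le> (\<integral>x. (f x - poly p x)\<^sup>2 \<partial>unif)"
proof -
  obtain c where c: "p = (\<Sum>i\<le>N. smult (c i) (legendre i))" using legendre_span assms by blast
  have "(\<integral>x. (f x - (\<Sum>i\<le>N. c i * poly (legendre i) x))\<^sup>2 \<partial>unif) =
    (\<integral>x. (f x)\<^sup>2 \<partial>unif) - (\<Sum>i\<le>N. (\<integral>x. f x * poly (legendre i) x \<partial>unif)\<^sup>2) +
    (\<Sum>i\<le>N. (c i - (\<integral>x. f x * poly (legendre i) x \<partial>unif))\<^sup>2)"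
    by (rule orthonormal_dist_squared) (auto intro: sq_int_poly assms simp: legendre_orthonormal)
  moreover have "poly p x = (\<Sum>i\<le>N. c i * poly (legendre i) x)" for x
    by (simp add: c poly_sum)
  ultimately show ?thesis by (simp add: sum_nonneg)
qed

section \<open>Polynomial approximation of step functions\<close>

text \<open>Chebyshev polynomials of the first kind, which turn cosine sums in t into polynomials in
  cos t.\<close>

fun cheb :: "nat \<Rightarrow> real poly" where
  "cheb 0 = 1"
| "cheb (Suc 0) = [:0, 1:]"
| "cheb (Suc (Suc n)) = [:0, 2:] * cheb (Suc n) - cheb n"

lemma degree_cheb: "degree (cheb n) \<le> n"
proof (induction n rule: cheb.induct)
  case (3 n)
  have "degree ([:0, 2:] * cheb (Suc n)) \<le> Suc (Suc n)"
    using degree_mult_le[of "[:0, 2:]" "cheb (Suc n)"] 3 by simp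
  then show ?case using 3 by (auto intro!: degree_diff_le)
qed auto

lemma poly_cheb_cos: "poly (cheb n) (cos t) = cos (real n * t)"
proof (induction n rule: cheb.induct)
  case (3 n)
  have "cos (real (Suc (Suc n)) * t) + cos (real n * t) = 2 * cos t * cos (real (Suc n) * t)"
    using cos_plus_cos[of "real (Suc (Suc n)) * t" "real n * t"] by (simp add: algebra_simps add_divide_distrib)
  then show ?case using 3 by simp
qed auto

section \<open>Fourier cosine expansion of the square wave on [0, pi]\<close>

definition unif_pi :: "real measure" where
  "unif_pi = density lborel (indicator {0..pi})"

lemma space_unif_pi [simp]: "space unif_pi = UNIV"
  and sets_unif_pi [simp, measurable_cong]: "sets unif_pi = sets borel"
  by (auto simp: unif_pi_def)

interpretation unif_pi: finite_measure unif_pi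
  by standard (simp add: unif_pi_def emeasure_density)

lemma integral_unif_pi:
  fixes f :: "real \<Rightarrow> real"
  shows "f \<in> borel_measurable borel \<Longrightarrow> (\<integral>x. f x \<partial>unif_pi) = (LINT x:{0..pi}|lborel. f x)"
  unfolding unif_pi_def set_lebesgue_integral_def
  using integral_density[of f lborel "indicator {0..pi}"] by (simp add: ennreal_indicator[abs_def])

lemma integrable_unif_pi:
  fixes f :: "real \<Rightarrow> real"
  shows "f \<in> borel_measurable borel \<Longrightarrow> integrable unif_pi f \<longleftrightarrow> set_integrable lborel {0..pi} f"
  unfolding unif_pi_def set_integrable_def
  using integrable_density[of f lborel "indicator {0..pi}"] by (simp add: ennreal_indicator[abs_def])

lemma integral_cos_multiple:
  fixes a b c :: real
  assumes "a \<le> b" "c \<noteq> 0"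
  shows "(LINT t:{a..b}|lborel. cos (c * t)) = sin (c * b) / c - sin (c * a) / c"
proof -
  have d: "((\<lambda>t. sin (c * t) / c) has_real_derivative cos (c * x)) (at x within {a..b})" for x
    by (rule derivative_eq_intros refl | simp add: assms(2))+
  have c: "continuous_on {a..b} (\<lambda>t. cos (c * t))"
    by (intro continuous_intros)
  show ?thesis
    unfolding set_lebesgue_integral_def
    using integral_FTC_Icc[OF assms(1) _ c, of "\<lambda>t. sin (c * t) / c"] d 
    unfolding has_real_derivative_iff_has_vector_derivative by blast
qed

lemma sin_int_multiple_pi: "sin (real_of_int k * pi) = 0"
  using sin_npi_int[of k] by (simp add: mult.commute)

text \<open>Only odd frequencies occur: the square wave changes sign under reflection at pi/2, so
  its even cosine coefficients vanish.\<close>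

lemma integral_cos_cos:
  "(\<integral>t. cos (real (2*i+1) * t) * cos (real (2*j+1) * t) \<partial>unif_pi) = (if i = j then pi / 2 else 0)"
proof -
  let ?a = "real (2*i+1)" and ?b = "real (2*j+1)"
  have sp: "sin ((?a + ?b) * pi) = 0" "sin ((?a - ?b) * pi) = 0"
    using sin_int_multiple_pi[of "int (2*i+1) + int (2*j+1)"] sin_int_multiple_pi[of "int (2*i+1) - int (2*j+1)"]
    by simp_all
  have si: "set_integrable lborel {0..pi} (\<lambda>t. cos (c * t))" for c :: real
    by (intro borel_integrable_atLeastAtMost' continuous_intros)
  have "(\<integral>t. cos (?a * t) * cos (?b * t) \<partial>unif_pi) =
      (LINT t:{0..pi}|lborel. cos (?a * t) * cos (?b * t))"
    by (rule integral_unif_pi) auto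
  also have "\<dots> = (LINT t:{0..pi}|lborel. (cos ((?a - ?b) * t) + cos ((?a + ?b) * t)) / 2)"
    by (simp add: cos_times_cos left_diff_distrib distrib_right)
  also have "\<dots> = ((LINT t:{0..pi}|lborel. cos ((?a - ?b) * t)) + (LINT t:{0..pi}|lborel. cos ((?a + ?b) * t))) / 2"
    using si[of "?a - ?b"] si[of "?a + ?b"] by (simp add: set_integral_add)
  also have "(LINT t:{0..pi}|lborel. cos ((?a + ?b) * t)) = 0"
    using sp by (subst integral_cos_multiple) auto
  also have "(LINT t:{0..pi}|lborel. cos ((?a - ?b) * t)) = (if i = j then pi else 0)"
  proof (cases "i = j")
    case False
    then show ?thesis using sp by (subst integral_cos_multiple) auto
  qed (simp add: set_lebesgue_integral_def)
  finally show ?thesis by (auto simp del: of_nat_add of_nat_mult)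
qed

text \<open>On [0, pi] this is twice the step function at \<open>u = - cos t\<close>, minus 1; the
  symmetric values 1 and -1 remove the constant Fourier term.\<close>

definition square_wave :: "real \<Rightarrow> real" where
  "square_wave t = (if t \<le> pi / 2 then 1 else -1)"

lemma measurable_square_wave [measurable]: "square_wave \<in> borel_measurable borel"
  unfolding square_wave_def by measurable

lemma integral_square_wave_cos:
  "(\<integral>t. square_wave t * cos (real (2*j+1) * t) \<partial>unif_pi) = 2 * (-1)^j / real (2*j+1)"
proof -
  let ?b = "real (2*j+1)"
  have si: "set_integrable lborel {a..b} (\<lambda>t. cos (?b * t))" for a b :: real
    by (intro borel_integrable_atLeastAtMost' continuous_intros)
  have s1: "sin (?b * pi) = 0"
    using sin_int_multiple_pi[of "int (2*j+1)"] by simp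
  have s2: "sin (?b * (pi / 2)) = (-1)^j"
  proof -
    have "?b * (pi / 2) = real j * pi + pi / 2" by (simp add: field_simps)
    then show ?thesis by (simp only: sin_add) (simp add: mult.commute)
  qed
  have "(\<integral>t. square_wave t * cos (?b * t) \<partial>unif_pi) =
      (LINT t:{0..pi}|lborel. square_wave t * cos (?b * t))"
    by (rule integral_unif_pi) auto
  also have "\<dots> = (LINT t|lborel. indicator {0..pi/2} t *\<^sub>R cos (?b * t) - indicator {pi/2..pi} t *\<^sub>R cos (?b * t))"
    unfolding set_lebesgue_integral_def
  proof (rule integral_cong_AE)
    have "AE t in lborel. t \<noteq> pi / 2" by (rule AE_lborel_singleton)
    then show "AE t in lborel. indicator {0..pi} t *\<^sub>R (square_wave t * cos (?b * t)) =
       indicator {0..pi/2} t *\<^sub>R cos (?b * t) - indicator {pi/2..pi} t *\<^sub>R cos (?b * t)"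
      by eventually_elim (auto simp: indicator_def square_wave_def)
  qed measurable
  also have "\<dots> = (LINT t:{0..pi/2}|lborel. cos (?b * t)) - (LINT t:{pi/2..pi}|lborel. cos (?b * t))"
    unfolding set_lebesgue_integral_def using si unfolding set_integrable_def by simp
  also have "\<dots> = 2 * (-1)^j / ?b"
    using s1 s2 by (simp add: integral_cos_multiple)
  finally show ?thesis .
qed

lemma integral_square_wave_squared: "(\<integral>t. (square_wave t)\<^sup>2 \<partial>unif_pi) = pi"
proof -
  have "(\<integral>t. (square_wave t)\<^sup>2 \<partial>unif_pi) = (\<integral>t. 1 \<partial>unif_pi)"
    by (rule Bochner_Integration.integral_cong) (auto simp: square_wave_def)
  also have "\<dots> = pi" by (subst integral_unif_pi) (auto simp: set_lebesgue_integral_def)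
  finally show ?thesis .
qed

text \<open>The even terms make up a quarter of the Basel sum, which leaves
  \<open>pi\<^sup>2 / 6 - pi\<^sup>2 / 24\<close>.\<close>

lemma odd_inverse_squares_sums: "(\<lambda>n. 1 / (2 * real n + 1)\<^sup>2) sums (pi\<^sup>2 / 8)"
proof -
  have B: "(\<lambda>n. 1 / (real n + 1)\<^sup>2) sums (pi\<^sup>2 / 6)"
    using inverse_squares_sums by (simp add: add.commute)
  have "(\<lambda>n. \<Sum>k\<in>{n*2..<n*2+2}. 1 / (real k + 1)\<^sup>2) sums (pi\<^sup>2 / 6)"
    by (rule sums_group[OF B]) simp
  then have "(\<lambda>n. 1 / (2 * real n + 1)\<^sup>2 + 1 / (2 * real n + 2)\<^sup>2) sums (pi\<^sup>2 / 6)"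
    by (simp add: numeral_2_eq_2 algebra_simps)
  moreover have "(\<lambda>n. 1 / (2 * real n + 2)\<^sup>2) sums (pi\<^sup>2 / 24)"
  proof -
    have "(\<lambda>n. 1 / 4 * (1 / (real n + 1)\<^sup>2)) sums (1 / 4 * (pi\<^sup>2 / 6))"
      by (rule sums_mult[OF B])
    moreover have "1 / 4 * (1 / (real n + 1)\<^sup>2) = 1 / (2 * real n + 2)\<^sup>2" for n
    proof -
      have "(2 * real n + 2)\<^sup>2 = 4 * (real n + 1)\<^sup>2" by (simp add: power2_eq_square algebra_simps)
      then show ?thesis by simp
    qed
    ultimately show ?thesis by simp
  qed
  ultimately have "(\<lambda>n. (1 / (2 * real n + 1)\<^sup>2 + 1 / (2 * real n + 2)\<^sup>2) - 1 / (2 * real n + 2)\<^sup>2)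
      sums (pi\<^sup>2 / 6 - pi\<^sup>2 / 24)"
    by (rule sums_diff)
  then show ?thesis by simp
qed

text \<open>Each term satisfies \<open>1 / (2 * k + 1)\<^sup>2 \<le> 1 / (4 * k * (k + 1))\<close>,
  and the majorant telescopes.\<close>

lemma odd_inverse_squares_tail:
  "pi\<^sup>2 / 8 - (\<Sum>j\<le>J. 1 / (2 * real j + 1)\<^sup>2) \<le> 1 / (4 * (real J + 1))"
proof -
  let ?f = "\<lambda>n. 1 / (2 * real n + 1)\<^sup>2"
  have s1: "(\<lambda>n. ?f (n + Suc J)) sums (pi\<^sup>2 / 8 - (\<Sum>j<Suc J. ?f j))"
    using odd_inverse_squares_sums by (rule sums_split_initial_segment)
  have s2: "(\<lambda>n. 1 / (4 * (real (n + Suc J))) - 1 / (4 * (real (Suc n + Suc J)))) sums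
      (1 / (4 * real (0 + Suc J)) - 0)"
  proof (rule telescope_sums')
    have "(\<lambda>n. 1 / 4 * inverse (real (Suc (n + J)))) \<longlonglongrightarrow> 1 / 4 * 0"
      by (intro tendsto_mult tendsto_const LIMSEQ_ignore_initial_segment[OF LIMSEQ_inverse_real_of_nat])
    then show "(\<lambda>n. 1 / (4 * real (n + Suc J))) \<longlonglongrightarrow> 0"
      by (simp add: divide_simps)
  qed
  have le: "?f (n + Suc J) \<le> 1 / (4 * (real (n + Suc J))) - 1 / (4 * (real (Suc n + Suc J)))" for n
  proof -
    define k where "k = real (n + Suc J)"
    have "k > 0" by (simp add: k_def)
    have "1 / (2 * k + 1)\<^sup>2 \<le> 1 / (4 * k * (k + 1))"
    proof (rule frac_le)
      show "0 < 4 * k * (k + 1)" using \<open>k > 0\<close> by simp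
      show "4 * k * (k + 1) \<le> (2 * k + 1)\<^sup>2" by (simp add: power2_eq_square algebra_simps)
    qed auto
    also have "\<dots> = 1 / (4 * k) - 1 / (4 * (k + 1))"
      using \<open>k > 0\<close> by (simp add: field_simps)
    finally show ?thesis by (simp add: k_def algebra_simps)
  qed
  have "pi\<^sup>2 / 8 - (\<Sum>j<Suc J. ?f j) \<le> 1 / (4 * real (0 + Suc J)) - 0"
    by (rule sums_le[OF le s1 s2])
  then show ?thesis by (simp add: lessThan_Suc_atMost algebra_simps)
qed

text \<open>The squared error is pi minus the sum of the squared coefficients; as
  \<open>pi = 8 / pi * (pi\<^sup>2 / 8)\<close>, this is 8/pi times the tail of the odd inverse
  squares.\<close>

lemma square_wave_approx:
  "(\<integral>t. (square_wave t - (\<Sum>j\<le>J. 4 * (-1)^j / (pi * (2 * real j + 1)) * cos (real (2*j+1) * t)))\<^sup>2 \<partial>unif_pi)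
    \<le> 2 / (pi * (real J + 1))"
proof -
  \<comment> \<open>Each cosine has squared norm pi/2, so \<open>r\<close> normalizes it.\<close>
  define r where "r = sqrt (2 / pi)"
  have r2: "r * r = 2 / pi" by (simp add: r_def)
  define \<phi> where "\<phi> j t = r * cos (real (2*j+1) * t)" for j t
  have inner: "(\<integral>t. square_wave t * \<phi> j t \<partial>unif_pi) = r * (2 * (-1)^j / (2 * real j + 1))" for j
  proof -
    have "(\<integral>t. square_wave t * \<phi> j t \<partial>unif_pi) = r * (\<integral>t. square_wave t * cos (real (2*j+1) * t) \<partial>unif_pi)"
      unfolding \<phi>_def by (subst integral_mult_right_zero[symmetric]) (simp only: mult_ac)
    then show ?thesis by (simp only: integral_square_wave_cos) simp
  qed
  have "(\<integral>t. (square_wave t - (\<Sum>j\<in>{..J}. (r * (2 * (-1)^j / (2 * real j + 1))) * \<phi> j t))\<^sup>2 \<partial>unif_pi) =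
    (\<integral>t. (square_wave t)\<^sup>2 \<partial>unif_pi) - (\<Sum>j\<le>J. (\<integral>t. square_wave t * \<phi> j t \<partial>unif_pi)\<^sup>2) +
    (\<Sum>j\<le>J. ((r * (2 * (-1)^j / (2 * real j + 1))) - (\<integral>t. square_wave t * \<phi> j t \<partial>unif_pi))\<^sup>2)"
  proof (rule orthonormal_dist_squared)
    show "sq_int unif_pi (\<phi> i)" for i
      unfolding \<phi>_def by (intro sq_int_scale unif_pi.sq_int_bounded[of _ 1]) auto
    show "sq_int unif_pi square_wave"
      by (intro unif_pi.sq_int_bounded[of _ 1]) (auto simp: square_wave_def)
    show "(\<integral>x. \<phi> i x * \<phi> j x \<partial>unif_pi) = (if i = j then 1 else 0)" for i j
    proof -
      have "(\<integral>x. \<phi> i x * \<phi> j x \<partial>unif_pi) = r * r * (\<integral>t. cos (real (2*i+1) * t) * cos (real (2*j+1) * t) \<partial>unif_pi)"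
        unfolding \<phi>_def by (subst integral_mult_right_zero[symmetric]) (simp only: mult_ac)
      then show ?thesis unfolding integral_cos_cos r2 by simp
    qed
  qed simp
  also have "\<dots> = pi - (\<Sum>j\<le>J. 8 / pi * (1 / (2 * real j + 1)\<^sup>2))"
  proof -
    have "(r * (2 * (-1)^j / (2 * real j + 1)))\<^sup>2 = 8 / pi * (1 / (2 * real j + 1)\<^sup>2)" for j
    proof -
      have "(r * (2 * (-1)^j / (2 * real j + 1)))\<^sup>2 = r * r * 4 * ((-1)^j * (-1)^j) / (2 * real j + 1)\<^sup>2"
        by (simp add: power2_eq_square)
      also have "((-1)^j * (-1)^j) = (1::real)" by (simp flip: power_add)
      finally show ?thesis by (simp add: r2)
    qed
    then show ?thesis by (simp only: inner integral_square_wave_squared) simp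
  qed
  also have "\<dots> = 8 / pi * (pi\<^sup>2 / 8 - (\<Sum>j\<le>J. 1 / (2 * real j + 1)\<^sup>2))"
    by (simp add: sum_distrib_left right_diff_distrib power2_eq_square)
  also have "\<dots> \<le> 8 / pi * (1 / (4 * (real J + 1)))"
    by (intro mult_left_mono odd_inverse_squares_tail) auto
  also have "\<dots> = 2 / (pi * (real J + 1))"
    by (simp add: divide_simps)
  finally have approx: "(\<integral>t. (square_wave t - (\<Sum>j\<le>J. (r * (2 * (-1)^j / (2 * real j + 1))) * \<phi> j t))\<^sup>2 \<partial>unif_pi)
      \<le> 2 / (pi * (real J + 1))" .
  have "(\<Sum>j\<in>{..J}. (r * (2 * (-1)^j / (2 * real j + 1))) * \<phi> j t) =
      (\<Sum>j\<le>J. 4 * (-1)^j / (pi * (2 * real j + 1)) * cos (real (2*j+1) * t))" for t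
  proof (rule sum.cong)
    fix j
    have "(r * (2 * (-1)^j / (2 * real j + 1))) * \<phi> j t = (r * r) * (2 * (-1)^j / (2 * real j + 1)) * cos (real (2*j+1) * t)"
      by (simp add: \<phi>_def)
    then show "(r * (2 * (-1)^j / (2 * real j + 1))) * \<phi> j t =
        4 * (-1)^j / (pi * (2 * real j + 1)) * cos (real (2*j+1) * t)"
      unfolding r2 by simp
  qed simp
  then show ?thesis using approx by simp
qed

text \<open>The truncated cosine series has the frequencies 1, 3, ..., 2 * J + 1 and is therefore a
  polynomial of degree at most 2 * J + 1 in \<open>- cos t\<close>.\<close>

lemma poly_step_approx:
  "\<exists>S :: real poly. degree S \<le> N \<and>
    (LINT u:{-1..1}|lborel. ((if u \<le> 0 then 1 else 0) - poly S u)\<^sup>2) \<le> 1 / (real N + 1)"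
proof (cases "N = 0")
  \<comment> \<open>No odd frequency fits into degree 0, but the zero polynomial already has squared
    error 1.\<close>
  case True
  have "(LINT u:{-1..1}|lborel. ((if u \<le> 0 then 1 else 0) - poly (0 :: real poly) u)\<^sup>2) =
    (LINT u:{-1..0::real}|lborel. (1::real))"
    unfolding set_lebesgue_integral_def
    by (rule Bochner_Integration.integral_cong) (auto simp: indicator_def)
  also have "\<dots> = 1" by (simp add: set_lebesgue_integral_def)
  finally show ?thesis using True by (intro exI[of _ 0]) auto
next
  case False
  \<comment> \<open>The largest J with \<open>2 * J + 1 \<le> N\<close>; the factor 1/3 below is
    attained at N = 2.\<close>
  define J where "J = (N - 1) div 2"
  have J: "2 * J + 1 \<le> N" "real J + 1 \<ge> (real N + 1) / 3" using False by (auto simp: J_def)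
  define b where "b j = 4 * (-1)^j / (pi * (2 * real j + 1))" for j
  \<comment> \<open>Composition with -x undoes the sign in \<open>u = - cos t\<close>; halving and
    adding 1/2 turns the values 1 and -1 into 1 and 0.\<close>
  define S where "S = [:1/2:] + smult (1/2) (\<Sum>j\<le>J. smult (b j) (pcompose (cheb (2*j+1)) [:0, -1:]))"
  have "degree (pcompose (cheb (2*j+1)) [:0, -1:]) \<le> N" if "j \<le> J" for j
    using degree_cheb[of "2*j+1"] J that by (simp add: degree_pcompose)
  then have "degree (\<Sum>j\<le>J. smult (b j) (pcompose (cheb (2*j+1)) [:0, -1:])) \<le> N"
    by (intro degree_sum_le) (auto intro: order_trans[OF degree_smult_le])
  then have deg: "degree S \<le> N"
    unfolding S_def by (intro degree_add_le) (auto intro: order_trans[OF degree_smult_le])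
  define f where "f u = ((if u \<le> 0 then 1 else 0) - poly S u)\<^sup>2" for u :: real
  have f_meas [measurable]: "f \<in> borel_measurable borel" unfolding f_def by measurable
  let ?w = "\<lambda>t. \<Sum>j\<le>J. b j * cos (real (2*j+1) * t)"
  have f_cos: "f (- cos t) = 1 / 4 * (square_wave t - ?w t)\<^sup>2" if t: "0 \<le> t" "t \<le> pi" for t
  proof -
    have "(- cos t \<le> 0) = (t \<le> pi / 2)"
    proof
      assume "- cos t \<le> 0"
      show "t \<le> pi / 2"
      proof (rule ccontr)
        assume "\<not> t \<le> pi / 2"
        then have "cos t < cos (pi / 2)" using t by (intro cos_monotone_0_pi) auto
        then show False using \<open>- cos t \<le> 0\<close> by simp
      qed
    next
      assume "t \<le> pi / 2"
      then show "- cos t \<le> 0" using t cos_ge_zero[of t] by simp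
    qed
    moreover have "poly S (- cos t) = 1 / 2 + 1 / 2 * ?w t"
      by (simp add: S_def poly_sum poly_pcompose poly_cheb_cos del: of_nat_add of_nat_mult)
    moreover have "(1 - (1 / 2 + 1 / 2 * W))\<^sup>2 = 1 / 4 * (1 - W)\<^sup>2"
      "(0 - (1 / 2 + 1 / 2 * W))\<^sup>2 = 1 / 4 * (-1 - W)\<^sup>2" for W :: real
      by (simp_all add: power2_eq_square algebra_simps)
    ultimately show ?thesis
      by (cases "t \<le> pi / 2") (simp_all add: f_def square_wave_def)
  qed
  have w_meas [measurable]: "?w \<in> borel_measurable borel" by measurable
  have w_int: "integrable unif_pi (\<lambda>t. 1 / 4 * (square_wave t - ?w t)\<^sup>2)"
  proof -
    have "sq_int unif_pi (\<lambda>t. square_wave t - ?w t)"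
      by (intro sq_int_diff sq_int_sum sq_int_scale unif_pi.sq_int_bounded[of _ 1])
         (auto simp: square_wave_def)
    then show ?thesis by (simp add: sq_int_def)
  qed
  obtain B where B: "\<And>u. u \<in> {-1..1} \<Longrightarrow> \<bar>poly S u\<bar> \<le> B"
  proof -
    have "bounded (poly S ` {-1..1})"
      by (intro compact_imp_bounded compact_continuous_image continuous_on_poly continuous_on_id) auto
    then show ?thesis using that unfolding bounded_real by blast
  qed
  have f_le: "\<bar>f u\<bar> \<le> (1 + B)\<^sup>2" if "u \<in> {-1..1}" for u
  proof -
    have "\<bar>(if u \<le> 0 then 1 else 0) - poly S u\<bar> \<le> \<bar>1 + B\<bar>" using B[OF that] by auto
    then show ?thesis unfolding f_def by (simp add: abs_le_square_iff)
  qed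
  have f_int: "set_integrable lborel {- cos 0..- cos pi} f"
    unfolding set_integrable_def
  proof (rule Bochner_Integration.integrable_bound)
    show "integrable lborel (\<lambda>u. indicator {-1..1 :: real} u *\<^sub>R (1 + B)\<^sup>2)" by simp
    show "AE u in lborel. norm (indicator {- cos 0..- cos pi} u *\<^sub>R f u) \<le> norm (indicator {-1..1} u *\<^sub>R (1 + B)\<^sup>2)"
      using f_le by (auto simp: indicator_def)
  qed measurable
  have deriv: "((\<lambda>t. - cos t) has_real_derivative sin t) (at t)" for t
    by (auto intro!: derivative_eq_intros)
  have sub: "(LINT u|lborel. f u * indicator {- cos 0..- cos pi} u) =
      (LINT t|lborel. f (- cos t) * sin t * indicator {0..pi} t)"
    by (rule integral_substitution[OF f_int deriv]) (auto intro!: continuous_intros sin_ge_zero)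
  have sub_int: "set_integrable lborel {0..pi} (\<lambda>t. f (- cos t) * sin t)"
    by (rule integral_substitution[OF f_int deriv]) (auto intro!: continuous_intros sin_ge_zero)
  have "(LINT u:{-1..1}|lborel. f u) = (LINT t:{0..pi}|lborel. f (- cos t) * sin t)"
    using sub by (simp add: set_lebesgue_integral_def mult.commute)
  \<comment> \<open>The Jacobian sin t is at most 1 and the squared error is nonnegative, so
    dropping the Jacobian leaves the unweighted error of the square wave as an upper bound.\<close>
  also have "\<dots> \<le> (LINT t:{0..pi}|lborel. 1 / 4 * (square_wave t - ?w t)\<^sup>2)"
  proof (rule set_integral_mono)
    show "set_integrable lborel {0..pi} (\<lambda>t. 1 / 4 * (square_wave t - ?w t)\<^sup>2)"
      using w_int by (subst integrable_unif_pi[symmetric]) auto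
    show "f (- cos t) * sin t \<le> 1 / 4 * (square_wave t - ?w t)\<^sup>2" if "t \<in> {0..pi}" for t
      using that by (subst f_cos) (auto intro!: mult_left_le)
  qed (rule sub_int)
  also have "\<dots> = (\<integral>t. 1 / 4 * (square_wave t - ?w t)\<^sup>2 \<partial>unif_pi)"
    by (rule integral_unif_pi[symmetric]) measurable
  also have "\<dots> = 1 / 4 * (\<integral>t. (square_wave t - ?w t)\<^sup>2 \<partial>unif_pi)"
    by (rule integral_mult_right_zero)
  also have "\<dots> \<le> 1 / 4 * (2 / (pi * (real J + 1)))"
    unfolding b_def by (intro mult_left_mono square_wave_approx) auto
  \<comment> \<open>Here pi > 3 compensates the factor 1/3 in the bound for J.\<close>
  also have "\<dots> \<le> 1 / 4 * (2 / (3 * ((real N + 1) / 3)))"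
    using J(2) pi_gt3 by (intro mult_left_mono divide_left_mono mult_mono mult_pos_pos) auto
  also have "\<dots> \<le> 1 / (real N + 1)" by (simp add: divide_simps)
  finally show ?thesis using deg unfolding f_def by blast
qed

section \<open>Polynomial approximation of indicators of intervals\<close>

lemma integral_diff_squared_le:
  assumes "sq_int M f" "sq_int M g"
  shows "(\<integral>x. (f x - g x)\<^sup>2 \<partial>M) \<le> 2 * (\<integral>x. (f x)\<^sup>2 \<partial>M) + 2 * (\<integral>x. (g x)\<^sup>2 \<partial>M)"
proof -
  have "(\<integral>x. (f x - g x)\<^sup>2 \<partial>M) \<le> (\<integral>x. 2 * (f x)\<^sup>2 + 2 * (g x)\<^sup>2 \<partial>M)"
  proof (rule integral_mono)
    show "integrable M (\<lambda>x. (f x - g x)\<^sup>2)" using sq_int_diff[OF assms] by (simp add: sq_int_def)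
    show "integrable M (\<lambda>x. 2 * (f x)\<^sup>2 + 2 * (g x)\<^sup>2)" using assms by (simp add: sq_int_def)
    show "(f x - g x)\<^sup>2 \<le> 2 * (f x)\<^sup>2 + 2 * (g x)\<^sup>2" for x
      using zero_le_power2[of "f x + g x"] by (simp add: power2_sum power2_diff)
  qed
  also have "\<dots> = 2 * (\<integral>x. (f x)\<^sup>2 \<partial>M) + 2 * (\<integral>x. (g x)\<^sup>2 \<partial>M)"
    using assms by (simp add: sq_int_def)
  finally show ?thesis .
qed

lemma sq_int_indicator: "A \<in> sets borel \<Longrightarrow> sq_int unif (indicator A)"
  by (intro unif.sq_int_bounded[of _ 1]) auto

text \<open>Translation by \<open>a\<close> moves [0,1] to [-a, 1 - a], which lies in [-1,1] for
  every \<open>a\<close> in [0,1]; this is why the step was approximated on the symmetric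
  interval.\<close>

lemma poly_indicator_atMost_approx:
  assumes "0 \<le> a" "a \<le> 1"
  shows "\<exists>p :: real poly. degree p \<le> N \<and> (\<integral>x. (indicator {..a} x - poly p x)\<^sup>2 \<partial>unif) \<le> 1 / (real N + 1)"
proof -
  obtain S :: "real poly" where S: "degree S \<le> N"
    "(LINT u:{-1..1}|lborel. ((if u \<le> 0 then 1 else 0) - poly S u)\<^sup>2) \<le> 1 / (real N + 1)"
    using poly_step_approx by blast
  define p where "p = pcompose S [:-a, 1:]"
  have "degree p \<le> N" using S by (simp add: p_def degree_pcompose)
  define f where "f u = ((if u \<le> 0 then 1 else 0) - poly S u)\<^sup>2" for u :: real
  have [measurable]: "f \<in> borel_measurable borel" unfolding f_def by measurable
  obtain B where B: "\<And>u. u \<in> {-1..1} \<Longrightarrow> \<bar>poly S u\<bar> \<le> B"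
  proof -
    have "bounded (poly S ` {-1..1})"
      by (intro compact_imp_bounded compact_continuous_image continuous_on_poly continuous_on_id) auto
    then show ?thesis using that unfolding bounded_real by blast
  qed
  have f_le: "\<bar>f u\<bar> \<le> (1 + B)\<^sup>2" if "u \<in> {-1..1}" for u
  proof -
    have "\<bar>(if u \<le> 0 then 1 else 0) - poly S u\<bar> \<le> \<bar>1 + B\<bar>" using B[OF that] by auto
    then show ?thesis unfolding f_def by (simp add: abs_le_square_iff)
  qed
  have int: "integrable lborel (\<lambda>u. indicator A u *\<^sub>R f u)" if "A \<subseteq> {-1..1}" "A \<in> sets borel" for A
  proof (rule Bochner_Integration.integrable_bound)
    show "integrable lborel (\<lambda>u. indicator {-1..1 :: real} u *\<^sub>R (1 + B)\<^sup>2)" by simp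
    show "AE u in lborel. norm (indicator A u *\<^sub>R f u) \<le> norm (indicator {-1..1} u *\<^sub>R (1 + B)\<^sup>2)"
    proof (rule AE_I2)
      show "norm (indicator A u *\<^sub>R f u) \<le> norm (indicator {-1..1} u *\<^sub>R (1 + B)\<^sup>2)" for u
        using f_le[of u] that by (cases "u \<in> A") auto
    qed
  qed (use that in measurable)
  have "(\<integral>x. (indicator {..a} x - poly p x)\<^sup>2 \<partial>unif) = (LINT x:{0..1}|lborel. (indicator {..a} x - poly p x)\<^sup>2)"
    by (rule integral_unif) measurable
  also have "\<dots> = (LINT x|lborel. indicator {0..1} x *\<^sub>R f (- a + x))"
    unfolding set_lebesgue_integral_def
    by (rule Bochner_Integration.integral_cong) (auto simp: f_def p_def poly_pcompose indicator_def)
  also have "\<dots> = (LINT u|lborel. indicator {0..1} (a + u) *\<^sub>R f u)"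
    by (subst lborel_integral_real_affine[where c = 1 and t = a]) auto
  also have "(\<lambda>u. indicator {0..1} (a + u) *\<^sub>R f u) = (\<lambda>u. indicator {-a..1-a} u *\<^sub>R f u)"
    by (auto simp: indicator_def fun_eq_iff)
  also have "(LINT u|lborel. indicator {-a..1-a} u *\<^sub>R f u) \<le> (LINT u|lborel. indicator {-1..1} u *\<^sub>R f u)"
    using assms by (intro integral_mono int) (auto simp: indicator_def f_def)
  also have "\<dots> \<le> 1 / (real N + 1)"
    using S(2) by (simp add: set_lebesgue_integral_def f_def)
  finally show ?thesis using \<open>degree p \<le> N\<close> by blast
qed

text \<open>Up to its left end point, a null set, an interval is the difference of two half-lines;
  the constant is 4 = 2 * (1 + 1).\<close>

lemma poly_indicator_interval_approx:
  fixes A :: "real set"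
  assumes "compact A" "convex A" "A \<subseteq> {0..1}"
  shows "\<exists>p :: real poly. degree p \<le> N \<and> (\<integral>x. (indicator A x - poly p x)\<^sup>2 \<partial>unif) \<le> 4 / (real N + 1)"
proof -
  obtain a b where A: "A = {a..b}"
    using assms connected_compact_interval_1[of A] convex_connected[of A] by blast
  show ?thesis
  proof (cases "a \<le> b")
    case False
    then show ?thesis using A by (intro exI[of _ 0]) auto
  next
    case True
    then have ab: "0 \<le> a" "a \<le> 1" "0 \<le> b" "b \<le> 1" using A assms(3) by auto
    obtain p :: "real poly" where p: "degree p \<le> N" "(\<integral>x. (indicator {..a} x - poly p x)\<^sup>2 \<partial>unif) \<le> 1 / (real N + 1)"
      using poly_indicator_atMost_approx[OF ab(1,2)] by blast
    obtain q :: "real poly" where q: "degree q \<le> N" "(\<integral>x. (indicator {..b} x - poly q x)\<^sup>2 \<partial>unif) \<le> 1 / (real N + 1)"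
      using poly_indicator_atMost_approx[OF ab(3,4)] by blast
    have "(\<integral>x. (indicator A x - poly (q - p) x)\<^sup>2 \<partial>unif) =
        (\<integral>x. ((indicator {..b} x - poly q x) - (indicator {..a} x - poly p x))\<^sup>2 \<partial>unif)"
    proof (rule integral_cong_AE)
      have "AE x in lborel. x \<noteq> a" by (rule AE_lborel_singleton)
      then have "AE x in unif. x \<noteq> a" unfolding AE_unif by eventually_elim simp
      then show "AE x in unif. (indicator A x - poly (q - p) x)\<^sup>2 =
          ((indicator {..b} x - poly q x) - (indicator {..a} x - poly p x))\<^sup>2"
        by eventually_elim (use True in \<open>auto simp: A indicator_def algebra_simps\<close>)
    qed (measurable, simp_all add: A)
    also have "\<dots> \<le> 2 * (\<integral>x. (indicator {..b} x - poly q x)\<^sup>2 \<partial>unif) + 2 * (\<integral>x. (indicator {..a} x - poly p x)\<^sup>2 \<partial>unif)"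
      by (intro integral_diff_squared_le sq_int_diff sq_int_indicator sq_int_poly) auto
    also have "\<dots> \<le> 4 / (real N + 1)" using p(2) q(2) by simp
    finally show ?thesis using degree_diff_le[OF q(1) p(1)] by blast
  qed
qed

text \<open>The difference of the two approximating polynomials is a competitor for the tail; the
  constant is 16 = 2 * (4 + 4).\<close>

lemma legendre_tail_indicators:
  fixes A B :: "real set"
  assumes "compact A" "convex A" "A \<subseteq> {0..1}" "compact B" "convex B" "B \<subseteq> {0..1}"
  defines "f \<equiv> \<lambda>x. indicator A x - indicator B x :: real"
  shows "(\<integral>x. (f x)\<^sup>2 \<partial>unif) - (\<Sum>i\<le>N. (\<integral>x. f x * poly (legendre i) x \<partial>unif)\<^sup>2) \<le> 16 / (real N + 1)"
proof -
  obtain p :: "real poly" where p: "degree p \<le> N" "(\<integral>x. (indicator A x - poly p x)\<^sup>2 \<partial>unif) \<le> 4 / (real N + 1)"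
    using poly_indicator_interval_approx[OF assms(1-3)] by blast
  obtain q :: "real poly" where q: "degree q \<le> N" "(\<integral>x. (indicator B x - poly q x)\<^sup>2 \<partial>unif) \<le> 4 / (real N + 1)"
    using poly_indicator_interval_approx[OF assms(4-6)] by blast
  have [measurable]: "A \<in> sets borel" "B \<in> sets borel"
    using assms by (auto intro: borel_compact)
  have "(\<integral>x. (f x)\<^sup>2 \<partial>unif) - (\<Sum>i\<le>N. (\<integral>x. f x * poly (legendre i) x \<partial>unif)\<^sup>2) \<le>
      (\<integral>x. (f x - poly (p - q) x)\<^sup>2 \<partial>unif)"
    unfolding f_def by (intro legendre_tail_le sq_int_diff sq_int_indicator degree_diff_le p q) auto
  also have "\<dots> = (\<integral>x. ((indicator A x - poly p x) - (indicator B x - poly q x))\<^sup>2 \<partial>unif)"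
    by (simp add: f_def algebra_simps)
  also have "\<dots> \<le> 2 * (\<integral>x. (indicator A x - poly p x)\<^sup>2 \<partial>unif) + 2 * (\<integral>x. (indicator B x - poly q x)\<^sup>2 \<partial>unif)"
    by (intro integral_diff_squared_le sq_int_diff sq_int_indicator sq_int_poly) auto
  also have "\<dots> \<le> 16 / (real N + 1)" using p(2) q(2) by simp
  finally show ?thesis .
qed

section \<open>Coefficients of the Legendre polynomials\<close>

text \<open>Majorization as for power series: \<open>q\<close> automatically has nonnegative
  coefficients, so their sum, \<open>poly q 1\<close>, dominates each coefficient of
  \<open>p\<close>.\<close>

definition coeff_le :: "real poly \<Rightarrow> real poly \<Rightarrow> bool" where
  "coeff_le p q \<longleftrightarrow> (\<forall>k. \<bar>coeff p k\<bar> \<le> coeff q k)"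

lemma coeff_le_mult:
  assumes "coeff_le p q" "coeff_le p' q'" shows "coeff_le (p * p') (q * q')"
  unfolding coeff_le_def coeff_mult
proof
  fix k
  have "\<bar>\<Sum>i\<le>k. coeff p i * coeff p' (k - i)\<bar> \<le> (\<Sum>i\<le>k. \<bar>coeff p i * coeff p' (k - i)\<bar>)"
    by (rule sum_abs)
  also have "\<dots> \<le> (\<Sum>i\<le>k. coeff q i * coeff q' (k - i))"
    using assms unfolding coeff_le_def abs_mult
    by (intro sum_mono mult_mono) (auto intro: order_trans[OF abs_ge_zero])
  finally show "\<bar>\<Sum>i\<le>k. coeff p i * coeff p' (k - i)\<bar> \<le> (\<Sum>i\<le>k. coeff q i * coeff q' (k - i))" .
qed

lemma coeff_le_prod:
  assumes "\<And>i. i \<in> I \<Longrightarrow> coeff_le (p i) (q i)" shows "coeff_le (\<Prod>i\<in>I. p i) (\<Prod>i\<in>I. q i)"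
  using assms
proof (induction I rule: infinite_finite_induct)
  case (insert i I)
  then show ?case by (simp add: coeff_le_mult)
qed (auto simp: coeff_le_def)

lemma coeff_le_imp_abs_coeff_le_poly_1:
  assumes "coeff_le p q" shows "\<bar>coeff p k\<bar> \<le> poly q 1"
proof -
  have nn: "coeff q i \<ge> 0" for i using assms unfolding coeff_le_def by (meson abs_ge_zero order_trans)
  have "\<bar>coeff p k\<bar> \<le> coeff q k" using assms by (simp add: coeff_le_def)
  also have "\<dots> \<le> poly q 1"
  proof (cases "k \<le> degree q")
    case True
    then have "coeff q k \<le> (\<Sum>i\<le>degree q. coeff q i)" by (intro member_le_sum) (auto simp: nn)
    then show ?thesis by (simp add: poly_altdef)
  next
    case False
    then show ?thesis by (simp add: coeff_eq_0 poly_altdef sum_nonneg nn)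
  qed
  finally show ?thesis .
qed

text \<open>These products are the denominators of Lagrange interpolation at equally spaced nodes,
  scaled to integers.\<close>

lemma prod_diff_fact:
  assumes "j \<le> N"
  shows "\<bar>\<Prod>i\<in>{..N}-{j}. real j - real i\<bar> = fact j * fact (N - j)"
proof -
  have split: "{..N} - {j} = {..<j} \<union> {j<..N}" using assms by auto
  have "(\<Prod>i\<in>{..N}-{j}. real j - real i) = (\<Prod>i<j. real j - real i) * (\<Prod>i\<in>{j<..N}. real j - real i)"
    unfolding split by (rule prod.union_disjoint) auto
  moreover have "\<bar>\<Prod>i<j. real j - real i\<bar> = fact j"
  proof -
    have "(\<Prod>i<j. real j - real i) = (\<Prod>i<j. real (j - i))" by (intro prod.cong) auto
    also have "\<dots> = fact j" by (simp add: fact_prod_rev lessThan_atLeast0 del: of_nat_diff)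
    finally show ?thesis by simp
  qed
  moreover have "\<bar>\<Prod>i\<in>{j<..N}. real j - real i\<bar> = fact (N - j)"
    using assms
  proof (induction N rule: dec_induct)
    case (step n)
    have "{j<..Suc n} = insert (Suc n) {j<..n}" using step by auto
    then show ?case using step by (simp add: abs_mult Suc_diff_le)
  qed simp
  ultimately show ?thesis by (simp add: abs_mult)
qed

lemma prod_add_fact: "(\<Prod>i\<in>{1..m}. real N + real i) = fact (N + m) / fact N"
proof (induction m)
  case (Suc m)
  have "(\<Prod>i\<in>{1..Suc m}. real N + real i) = fact (N + m) / fact N * (real N + real (Suc m))"
    using Suc by (simp add: prod.cl_ivl_Suc)
  then show ?case by (simp add: algebra_simps)
qed simp

text \<open>Lagrange interpolation at the nodes \<open>j / N\<close>: the values are at most 1, the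
  numerators are majorized by making all signs positive and evaluating at 1, and the denominators
  are products of factorials. The sum is (2N choose N) times 2^N.\<close>

lemma abs_coeff_le_interpolation:
  fixes Q :: "real poly"
  assumes deg: "degree Q \<le> N" and N: "N \<ge> 1" and bd: "\<And>x. 0 \<le> x \<Longrightarrow> x \<le> 1 \<Longrightarrow> \<bar>poly Q x\<bar> \<le> 1"
  shows "\<bar>coeff Q k\<bar> \<le> 8 ^ N"
proof -
  \<comment> \<open>\<open>l j\<close> is N^N times the usual Lagrange numerator, so that its value
    \<open>d j\<close> at the node \<open>j / N\<close> is a product of integers.\<close>
  define d where "d j = (\<Prod>i\<in>{..N}-{j}. real j - real i)" for j
  define l where "l j = (\<Prod>i\<in>{..N}-{j}. [:- real i, real N:])" for j
  have dl: "poly (l j) (real m / real N) = (if m = j then d j else 0)" if "j \<le> N" "m \<le> N" for j m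
  proof (cases "m = j")
    case True then show ?thesis using N by (simp add: l_def d_def poly_prod)
  next
    case False
    then have "m \<in> {..N} - {j}" using that by simp
    moreover have "poly [:- real m, real N:] (real m / real N) = 0" using N by simp
    ultimately show ?thesis using False unfolding l_def poly_prod by (simp add: prod_zero_iff)
  qed
  have d0: "d j \<noteq> 0" for j by (simp add: d_def)
  define R where "R = (\<Sum>j\<le>N. smult (poly Q (real j / real N) / d j) (l j))"
  have "Q = R"
  proof (rule poly_eqI_degree[where A = "(\<lambda>m. real m / real N) ` {..N}"])
    fix x assume "x \<in> (\<lambda>m. real m / real N) ` {..N}"
    then obtain m where m: "m \<le> N" "x = real m / real N" by auto
    have "poly R x = (\<Sum>j\<le>N. if j = m then poly Q x else 0)"
      unfolding R_def poly_sum using m d0 by (intro sum.cong) (auto simp: dl)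
    also have "\<dots> = poly Q x" using m by simp
    finally show "poly Q x = poly R x" by simp
  next
    have c: "card ((\<lambda>m. real m / real N) ` {..N}) = Suc N"
      using N by (subst card_image) (auto simp: inj_on_def)
    show "degree Q < card ((\<lambda>m. real m / real N) ` {..N})" using deg c by simp
    have "degree (l j) \<le> N" if "j \<le> N" for j
    proof -
      have "degree (l j) \<le> (\<Sum>i\<in>{..N}-{j}. degree [:- real i, real N:])"
        unfolding l_def
        using degree_prod_sum_le[of "{..N}-{j}" "\<lambda>i. [:- real i, real N:]"] by (simp add: o_def)
      also have "\<dots> \<le> (\<Sum>i\<in>{..N}-{j}. 1)" by (intro sum_mono) auto
      also have "\<dots> = N" using that by simp
      finally show ?thesis .
    qed
    then have "degree R \<le> N"
      unfolding R_def by (intro degree_sum_le) (auto intro: order_trans[OF degree_smult_le])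
    then show "degree R < card ((\<lambda>m. real m / real N) ` {..N})" using c by simp
  qed
  then have "\<bar>coeff Q k\<bar> = \<bar>coeff R k\<bar>" by (rule arg_cong)
  also have "\<dots> = \<bar>\<Sum>j\<le>N. poly Q (real j / real N) / d j * coeff (l j) k\<bar>"
    by (simp add: R_def coeff_sum)
  also have "\<dots> \<le> (\<Sum>j\<le>N. \<bar>poly Q (real j / real N) / d j * coeff (l j) k\<bar>)" by (rule sum_abs)
  also have "\<dots> \<le> (\<Sum>j\<le>N. real (2 * N choose N) * real (N choose j))"
  proof (rule sum_mono)
    fix j assume "j \<in> {..N}"
    then have j: "j \<le> N" by simp
    have "coeff_le (l j) (\<Prod>i\<in>{..N}-{j}. [:real i, real N:])"
      unfolding l_def by (rule coeff_le_prod) (auto simp: coeff_le_def coeff_pCons split: nat.splits)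
    then have "\<bar>coeff (l j) k\<bar> \<le> poly (\<Prod>i\<in>{..N}-{j}. [:real i, real N:]) 1"
      by (rule coeff_le_imp_abs_coeff_le_poly_1)
    also have "\<dots> = (\<Prod>i\<in>{..N}-{j}. real N + real i)"
      by (simp add: poly_prod add.commute)
    \<comment> \<open>The product is largest when the smallest factor, the one for i = 0, is
      omitted; both products are completed to the full one for the comparison.\<close>
    also have "\<dots> \<le> (\<Prod>i\<in>{1..N}. real N + real i)"
    proof -
      have "real N * (\<Prod>i\<in>{..N}-{j}. real N + real i) \<le> (real N + real j) * (\<Prod>i\<in>{..N}-{j}. real N + real i)"
        by (intro mult_right_mono prod_nonneg) auto
      also have "\<dots> = (\<Prod>i\<in>{..N}. real N + real i)"
        using j by (subst prod.remove[of "{..N}" j]) auto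
      also have "\<dots> = real N * (\<Prod>i\<in>{..N}-{0}. real N + real i)"
        by (subst prod.remove[of "{..N}" 0]) auto
      also have "{..N} - {0} = {1..N}" by auto
      finally show ?thesis using N by simp
    qed
    finally have l: "\<bar>coeff (l j) k\<bar> \<le> fact (2 * N) / fact N"
      by (simp only: prod_add_fact mult_2)
    have q: "\<bar>poly Q (real j / real N)\<bar> \<le> 1" using j N by (intro bd) auto
    have "\<bar>poly Q (real j / real N) / d j * coeff (l j) k\<bar> =
        \<bar>poly Q (real j / real N)\<bar> * \<bar>coeff (l j) k\<bar> / (fact j * fact (N - j))"
      using prod_diff_fact[OF j] by (simp add: abs_mult d_def)
    also have "\<dots> \<le> 1 * (fact (2 * N) / fact N) / (fact j * fact (N - j))"
      by (intro divide_right_mono mult_mono q l) auto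
    also have "\<dots> = real (2 * N choose N) * real (N choose j)"
      using j by (simp add: binomial_fact)
    finally show "\<bar>poly Q (real j / real N) / d j * coeff (l j) k\<bar> \<le> real (2 * N choose N) * real (N choose j)" .
  qed
  also have "\<dots> = real (2 * N choose N) * real (\<Sum>j\<le>N. N choose j)"
    by (simp add: sum_distrib_left)
  also have "(\<Sum>j\<le>N. N choose j) = 2 ^ N" by (rule choose_row_sum)
  also have "real (2 * N choose N) * real (2 ^ N) \<le> 2 ^ (2 * N) * 2 ^ N"
  proof -
    have "(2 * N choose N) \<le> (\<Sum>j\<le>2*N. 2 * N choose j)" by (intro member_le_sum) auto
    then have "(2 * N choose N) \<le> 2 ^ (2 * N)" by (simp only: choose_row_sum)
    then have "real (2 * N choose N) \<le> 2 ^ (2 * N)" by (metis of_nat_le_iff of_nat_numeral of_nat_power)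
    then show ?thesis by simp
  qed
  also have "(2::real) ^ (2 * N) * 2 ^ N = 8 ^ N"
    by (simp add: power_mult power_mult_distrib[symmetric])
  finally show ?thesis .
qed

text \<open>The interpolation bound is applied to the primitive of \<open>p\<close>, which is bounded by the \<open>L\<^sup>1\<close> norm
  of \<open>p\<close>.\<close>

lemma abs_coeff_le_L2:
  fixes p :: "real poly"
  assumes deg: "degree p \<le> n" and L2: "L2_inner p p \<le> 1"
  shows "\<bar>coeff p k\<bar> \<le> (real n + 1) * 8 ^ (n + 1)"
proof (cases "k \<le> n")
  case False
  then show ?thesis using deg by (simp add: coeff_eq_0)
next
  case True
  \<comment> \<open>The primitive vanishing at 0. Its degree n + 1 gives the exponent, and returning
    to the coefficients of \<open>p\<close> gives the factor \<open>real n + 1\<close>.\<close>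
  define Q where "Q = (\<Sum>i\<le>n. monom (coeff p i / real (Suc i)) (Suc i))"
  have cQ: "coeff Q (Suc i) = coeff p i / real (Suc i)" for i
  proof -
    have "coeff Q (Suc i) = (\<Sum>j\<le>n. if i = j then coeff p j / real (Suc j) else 0)"
      unfolding Q_def coeff_sum by (intro sum.cong) auto
    then show ?thesis using deg by (simp add: coeff_eq_0)
  qed
  have degQ: "degree Q \<le> n + 1"
    unfolding Q_def by (intro degree_sum_le) (auto intro: order_trans[OF degree_monom_le])
  have "pderiv Q = p"
    by (rule poly_eqI) (simp add: coeff_pderiv cQ del: of_nat_Suc)
  have Q0: "poly Q 0 = 0" by (simp add: Q_def poly_sum poly_monom)
  have absp: "(\<integral>x. \<bar>poly p x\<bar> \<partial>unif) \<le> 1"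
  proof -
    \<comment> \<open>The inequality between arithmetic and geometric mean replaces Cauchy-Schwarz,
      since both norms involved are at most 1.\<close>
    have "(\<integral>x. \<bar>poly p x\<bar> \<partial>unif) \<le> (\<integral>x. (1 + poly p x * poly p x) / 2 \<partial>unif)"
    proof (rule integral_mono)
      show "integrable unif (\<lambda>x. \<bar>poly p x\<bar>)"
        using sq_int_mult_integrable[OF sq_int_poly[of p] sq_int_poly[of 1]] by simp
      show "integrable unif (\<lambda>x. (1 + poly p x * poly p x) / 2)"
        using integrable_poly_mult[of p p] by simp
      show "\<bar>poly p x\<bar> \<le> (1 + poly p x * poly p x) / 2" for x
        using sum_squares_bound[of "\<bar>poly p x\<bar>" 1] by (simp add: power2_eq_square)
    qed
    also have "\<dots> = (1 + L2_inner p p) / 2"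
      using integrable_poly_mult[of p p] by (simp add: L2_inner_unif measure_def emeasure_unif_UNIV)
    finally show ?thesis using L2 by simp
  qed
  have "\<bar>poly Q x\<bar> \<le> 1" if "0 \<le> x" "x \<le> 1" for x
  proof -
    have deriv: "(poly Q has_vector_derivative poly p y) (at y within {0..x})" for y
      using poly_DERIV[of Q y] \<open>pderiv Q = p\<close>
      by (auto simp: has_real_derivative_iff_has_vector_derivative intro: has_vector_derivative_at_within)
    have cont: "continuous_on S (poly p)" for S by (intro continuous_on_poly continuous_on_id)
    have si: "set_integrable lborel {0..y} (poly p)" for y
      by (intro borel_integrable_atLeastAtMost' cont)
    have "(LINT t:{0..x}|lborel. poly p t) = poly Q x - poly Q 0"
      unfolding set_lebesgue_integral_def
      using integral_FTC_Icc[OF that(1) deriv cont] by simp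
    then have "\<bar>poly Q x\<bar> = \<bar>LINT t:{0..x}|lborel. poly p t\<bar>" using Q0 by simp
    also have "\<dots> \<le> (LINT t:{0..x}|lborel. \<bar>poly p t\<bar>)"
      using set_integral_norm_bound[OF si[of x]] by simp
    also have "\<dots> \<le> (LINT t:{0..1}|lborel. \<bar>poly p t\<bar>)"
      unfolding set_lebesgue_integral_def
      using set_integrable_abs[OF si[of x]] set_integrable_abs[OF si[of 1]] that
      by (intro integral_mono) (auto simp: set_integrable_def indicator_def)
    also have "\<dots> = (\<integral>t. \<bar>poly p t\<bar> \<partial>unif)" by (rule integral_unif[symmetric]) measurable
    finally show ?thesis using absp by simp
  qed
  then have "\<bar>coeff Q (Suc k)\<bar> \<le> 8 ^ (n + 1)"
    using abs_coeff_le_interpolation[OF degQ] by simp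
  then have "\<bar>coeff p k\<bar> \<le> real (Suc k) * 8 ^ (n + 1)"
    by (simp add: cQ abs_mult divide_simps mult.commute del: of_nat_Suc)
  also have "\<dots> \<le> (real n + 1) * 8 ^ (n + 1)"
    using True by (intro mult_right_mono) auto
  finally show ?thesis .
qed

lemma sum_coeff_legendre_squared_le:
  assumes "i \<le> n"
  shows "(\<Sum>k\<le>n. (coeff (legendre i) k)\<^sup>2) \<le> (real n + 1) ^ 3 * 64 ^ (n + 1)"
proof -
  have "(coeff (legendre i) k)\<^sup>2 \<le> ((real n + 1) * 8 ^ (n + 1))\<^sup>2" for k
    using abs_coeff_le_L2[of "legendre i" n k] assms
    by (simp add: degree_legendre L2_inner_legendre abs_le_square_iff[symmetric])
  then have "(\<Sum>k\<le>n. (coeff (legendre i) k)\<^sup>2) \<le> (\<Sum>k\<le>n. ((real n + 1) * 8 ^ (n + 1))\<^sup>2)"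
    by (rule sum_mono)
  also have "\<dots> = (real n + 1) * ((real n + 1)\<^sup>2 * (8\<^sup>2) ^ (n + 1))"
    by (simp only: sum_constant card_atMost power_mult_distrib power_mult[symmetric] mult.commute[of 2]) simp
  also have "\<dots> = (real n + 1) ^ 3 * 64 ^ (n + 1)"
    by (simp add: power3_eq_cube power2_eq_square)
  finally show ?thesis .
qed

section \<open>The Hilbert matrix\<close>

text \<open>Weighted AM-GM bounds \<open>2 * a i * a k\<close> by
  \<open>(a i)\<^sup>2 * (w i / w k) + (a k)\<^sup>2 * (w k / w i)\<close>. As \<open>h\<close> is
  symmetric, exchanging the summation indices identifies the two halves, and what remains are
  weighted row sums.\<close>

lemma schur_test:
  fixes h :: "'a \<Rightarrow> 'a \<Rightarrow> real" and a w :: "'a \<Rightarrow> real"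
  assumes h: "\<And>i k. i \<in> I \<Longrightarrow> k \<in> I \<Longrightarrow> h i k \<ge> 0" "\<And>i k. h i k = h k i"
    and w: "\<And>i. i \<in> I \<Longrightarrow> w i > 0"
    and row: "\<And>i. i \<in> I \<Longrightarrow> (\<Sum>k\<in>I. h i k * (w i / w k)) \<le> C"
  shows "(\<Sum>i\<in>I. \<Sum>k\<in>I. a i * a k * h i k) \<le> C * (\<Sum>i\<in>I. (a i)\<^sup>2)"
proof -
  let ?f = "\<lambda>i k. (a i)\<^sup>2 * (h i k * (w i / w k))"
  have "(\<Sum>i\<in>I. \<Sum>k\<in>I. a i * a k * h i k) \<le> (\<Sum>i\<in>I. \<Sum>k\<in>I. (?f i k + ?f k i) / 2)"
  proof (intro sum_mono)
    fix i k assume ik: "i \<in> I" "k \<in> I"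
    define s where "s = sqrt (w i / w k)"
    have s: "s > 0" "s\<^sup>2 = w i / w k" "(1 / s)\<^sup>2 = w k / w i"
      using w[OF ik(1)] w[OF ik(2)] by (auto simp: s_def power_divide)
    have "2 * (a i * a k) = 2 * (a i * s) * (a k * (1 / s))" using s(1) by simp
    also have "\<dots> \<le> (a i * s)\<^sup>2 + (a k * (1 / s))\<^sup>2" by (rule sum_squares_bound)
    also have "\<dots> = (a i)\<^sup>2 * (w i / w k) + (a k)\<^sup>2 * (w k / w i)" by (simp only: power_mult_distrib s)
    finally have "2 * (a i * a k) * h i k \<le> ((a i)\<^sup>2 * (w i / w k) + (a k)\<^sup>2 * (w k / w i)) * h i k"
      using h(1)[OF ik] by (rule mult_right_mono)
    then show "a i * a k * h i k \<le> (?f i k + ?f k i) / 2"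
      using h(2)[of k i] by (simp add: algebra_simps)
  qed
  also have "\<dots> = ((\<Sum>i\<in>I. \<Sum>k\<in>I. ?f i k) + (\<Sum>i\<in>I. \<Sum>k\<in>I. ?f k i)) / 2"
    by (simp only: sum.distrib sum_divide_distrib[symmetric])
  also have "(\<Sum>i\<in>I. \<Sum>k\<in>I. ?f k i) = (\<Sum>i\<in>I. \<Sum>k\<in>I. ?f i k)" by (rule sum.swap)
  also have "((\<Sum>i\<in>I. \<Sum>k\<in>I. ?f i k) + (\<Sum>i\<in>I. \<Sum>k\<in>I. ?f i k)) / 2 = (\<Sum>i\<in>I. \<Sum>k\<in>I. ?f i k)"
    by (simp only: add_divide_distrib field_sum_of_halves)
  also have "\<dots> = (\<Sum>i\<in>I. (a i)\<^sup>2 * (\<Sum>k\<in>I. h i k * (w i / w k)))"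
    by (simp only: sum_distrib_left)
  also have "\<dots> \<le> (\<Sum>i\<in>I. (a i)\<^sup>2 * C)" by (intro sum_mono mult_left_mono row) auto
  finally show ?thesis by (simp add: sum_distrib_left mult.commute)
qed

text \<open>Discrete analogue of the integral of 1/((x + y) sqrt y) over y > 0, which equals pi /
  sqrt x. The sum is split at k = i, and either part contributes at most
  \<open>2 / sqrt (i + 1)\<close>.\<close>

lemma hilbert_matrix_row_sum:
  "(\<Sum>k\<le>n. 1 / (real i + real k + 1) * (sqrt (real i + 1) / sqrt (real k + 1))) \<le> 4"
proof -
  let ?g = "\<lambda>k. 1 / ((real i + real k + 1) * sqrt (real k + 1))"
  \<comment> \<open>Meant for k \<le> i: the first factor is replaced by i + 1, and
    \<open>1 / sqrt (m + 1)\<close> is at most twice a difference of consecutive square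
    roots.\<close>
  have 1: "(\<Sum>k<m. ?g k) \<le> 2 * sqrt (real m) / (real i + 1)" for m
  proof (induction m)
    case (Suc m)
    have "?g m \<le> 1 / ((real i + 1) * sqrt (real m + 1))"
      by (intro divide_left_mono mult_right_mono mult_pos_pos) auto
    also have "\<dots> \<le> 2 * (sqrt (real m + 1) - sqrt (real m)) / (real i + 1)"
    proof -
      define u v where "u = sqrt (real m)" and "v = sqrt (real m + 1)"
      have uv: "v > 0" "u \<le> v" "v * v = u * u + 1" by (auto simp: u_def v_def)
      have "1 = (v - u) * (v + u)" using uv(3) by (simp add: algebra_simps)
      also have "\<dots> \<le> (v - u) * (2 * v)" using uv by (intro mult_left_mono) auto
      also have "\<dots> = 2 * (v - u) * v" by simp
      finally have "1 / v \<le> 2 * (v - u)" using uv by (simp only: pos_divide_le_eq)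
      then have "1 / sqrt (real m + 1) \<le> 2 * (sqrt (real m + 1) - sqrt (real m))"
        by (simp only: u_def v_def)
      then have "1 / sqrt (real m + 1) / (real i + 1) \<le> 2 * (sqrt (real m + 1) - sqrt (real m)) / (real i + 1)"
        by (intro divide_right_mono) auto
      then show ?thesis by (simp add: mult.commute)
    qed
    finally have "?g m \<le> 2 * sqrt (real (Suc m)) / (real i + 1) - 2 * sqrt (real m) / (real i + 1)"
      by (simp add: diff_divide_distrib algebra_simps)
    then show ?case using Suc by simp
  qed simp
  \<comment> \<open>Beyond k = i the first factor is replaced by k + 1, and the power -3/2 is
    compared with a telescoping difference.\<close>
  have 2: "(\<Sum>k<m. ?g k) \<le> 4 / sqrt (real i + 1) - 2 / sqrt (real m)" if "i + 1 \<le> m" for m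
    using that
  proof (induction m rule: dec_induct)
    case base
    have "2 * s / (s * s) = 2 / s" for s :: real by simp
    from this[of "sqrt (real i + 1)"]
    have "2 * sqrt (real (i + 1)) / (real i + 1) = 2 / sqrt (real i + 1)"
      by (simp add: add.commute)
    then have "(\<Sum>k<i+1. ?g k) \<le> 2 / sqrt (real i + 1)" using 1[of "i + 1"] by simp
    then show ?case by (simp add: add.commute)
  next
    case (step m)
    define u v where "u = sqrt (real m)" and "v = sqrt (real m + 1)"
    have u: "u > 0" "v > 0" "u \<le> v" "v * v = u * u + 1" using step by (auto simp: u_def v_def)
    have "?g m \<le> 1 / (v * v * v)"
      unfolding v_def by (intro divide_left_mono mult_right_mono mult_pos_pos) auto
    also have "\<dots> \<le> 2 / u - 2 / v"
    proof -
      have "2 / u - 2 / v = 2 * (v - u) / (u * v)"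
        using u by (simp add: diff_frac_eq algebra_simps)
      also have "\<dots> = 2 * (v - u) * (u + v) / (u * v * (u + v))"
        using u by simp
      also have "2 * (v - u) * (u + v) = 2" using u(4) by (simp add: algebra_simps)
      finally have e: "2 / u - 2 / v = 2 / (u * v * (u + v))" .
      have "u * v * (u + v) \<le> v * v * (v + v)" using u by (intro mult_mono add_mono) auto
      then have "2 / (v * v * (v + v)) \<le> 2 / (u * v * (u + v))"
        using u by (intro divide_left_mono mult_pos_pos add_pos_pos) auto
      moreover have "2 / (v * v * (v + v)) = 1 / (v * v * v)"
      proof -
        have "v * v * (v + v) = 2 * (v * v * v)" by (simp add: algebra_simps)
        then show ?thesis by simp
      qed
      ultimately show ?thesis using e by simp
    qed
    finally have "?g m \<le> 2 / sqrt (real m) - 2 / sqrt (real (Suc m))" by (simp add: u_def v_def add.commute)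
    then show ?case using step.IH by simp
  qed
  \<comment> \<open>Adding i nonnegative terms makes the upper limit at least i + 1, so the second
    estimate applies whether or not n reaches i.\<close>
  have "(\<Sum>k\<le>n. ?g k) \<le> (\<Sum>k<Suc n + i. ?g k)"
    by (intro sum_mono2) auto
  also have "\<dots> \<le> 4 / sqrt (real i + 1)"
  proof -
    have "0 \<le> 2 / sqrt (real (Suc n + i))" by simp
    then show ?thesis using 2[of "Suc n + i"] by linarith
  qed
  finally have "sqrt (real i + 1) * (\<Sum>k\<le>n. ?g k) \<le> 4"
    by (simp add: pos_le_divide_eq mult.commute)
  then show ?thesis by (simp add: sum_distrib_left)
qed

text \<open>Kernel and weight are products over the two coordinates, so each row sum is a product of
  two one-dimensional ones and 16 = 4 * 4.\<close>

lemma hilbert_form_2d: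
  fixes a :: "nat \<Rightarrow> nat \<Rightarrow> real"
  shows "(\<Sum>(i,j)\<in>{..N}\<times>{..N}. \<Sum>(k,l)\<in>{..N}\<times>{..N}. a i j * a k l * (1 / ((real i + real k + 1) * (real j + real l + 1))))
    \<le> 16 * (\<Sum>(i,j)\<in>{..N}\<times>{..N}. (a i j)\<^sup>2)"
proof -
  define h where "h x y = 1 / ((real (fst x) + real (fst y) + 1) * (real (snd x) + real (snd y) + 1))" for x y :: "nat \<times> nat"
  define w where "w x = sqrt (real (fst x) + 1) * sqrt (real (snd x) + 1)" for x :: "nat \<times> nat"
  have "(\<Sum>x\<in>{..N}\<times>{..N}. \<Sum>y\<in>{..N}\<times>{..N}. case_prod a x * case_prod a y * h x y) \<le> 16 * (\<Sum>x\<in>{..N}\<times>{..N}. (case_prod a x)\<^sup>2)"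
  proof (rule schur_test)
    show "w x > 0" for x by (simp add: w_def)
    show "h x y \<ge> 0" "h x y = h y x" for x y by (simp_all add: h_def add.commute)
    fix x assume "x \<in> {..N} \<times> {..N}"
    let ?r = "\<lambda>i k. 1 / (real i + real k + 1) * (sqrt (real i + 1) / sqrt (real k + 1))"
    have "(\<Sum>y\<in>{..N}\<times>{..N}. h x y * (w x / w y)) = (\<Sum>k\<le>N. ?r (fst x) k) * (\<Sum>l\<le>N. ?r (snd x) l)"
      unfolding sum_product sum.cartesian_product
      by (rule sum.cong) (auto simp: h_def w_def)
    also have "\<dots> \<le> 4 * 4"
      by (intro mult_mono hilbert_matrix_row_sum sum_nonneg) auto
    finally show "(\<Sum>y\<in>{..N}\<times>{..N}. h x y * (w x / w y)) \<le> 16" by simp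
  qed
  then show ?thesis by (simp add: h_def split_def)
qed

section \<open>Expansions on the square\<close>

abbreviation unif2 :: "(real \<times> real) measure" where
  "unif2 \<equiv> unif \<Otimes>\<^sub>M unif"

interpretation unif2: pair_sigma_finite unif unif ..

lemma measure_unif_UNIV [simp]: "measure unif UNIV = 1"
  by (simp add: measure_def emeasure_unif_UNIV)

interpretation unif2: finite_measure unif2
proof
  have "emeasure unif2 (UNIV \<times> UNIV) = 1"
    by (subst unif.emeasure_pair_measure_Times) (auto simp: emeasure_unif_UNIV)
  then show "emeasure unif2 (space unif2) \<noteq> \<infinity>" by (simp add: space_pair_measure)
qed

lemma AE_unif2I:
  assumes "\<And>x y. x \<in> {0..1} \<Longrightarrow> y \<in> {0..1} \<Longrightarrow> Q (x, y)"
  shows "AE z in unif2. Q z"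
proof -
  have "AE z in unif2. z \<in> {0..1} \<times> {0..1}"
  proof (rule unif2.AE_pair_measure)
    show "{z \<in> space unif2. z \<in> {0..1} \<times> {0..1}} \<in> sets unif2"
      by measurable
    show "AE x in unif. AE y in unif. (x, y) \<in> {0..1} \<times> {0..1}"
      by (intro AE_unifI) auto
  qed
  then show ?thesis
  proof eventually_elim
    case (elim z)
    then show ?case using assms[of "fst z" "snd z"] by (auto simp: mem_Times_iff)
  qed
qed

lemma sq_int_unif2:
  assumes "f \<in> borel_measurable unif2" "\<And>x y. x \<in> {0..1} \<Longrightarrow> y \<in> {0..1} \<Longrightarrow> \<bar>f (x, y)\<bar> \<le> B"
  shows "sq_int unif2 f"
  using assms by (intro unif2.sq_int_bounded[of f B] AE_unif2I) auto

lemma sq_int_unif: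
  assumes "f \<in> borel_measurable borel" "\<And>x. x \<in> {0..1} \<Longrightarrow> \<bar>f x\<bar> \<le> B"
  shows "sq_int unif f"
  using assms by (intro unif.sq_int_bounded[of f B] AE_unifI) auto

lemma sq_int_one: "finite_measure M \<Longrightarrow> sq_int M (\<lambda>_. 1)"
  by (intro finite_measure.sq_int_bounded[of M _ 1]) auto

lemma sq_int_unif_imp_integrable: "sq_int unif f \<Longrightarrow> integrable unif f"
  using sq_int_mult_integrable[of unif f "\<lambda>_. 1"] sq_int_one[OF unif.finite_measure_axioms] by simp

lemma sq_int_unif2_imp_integrable: "sq_int unif2 f \<Longrightarrow> integrable unif2 f"
  using sq_int_mult_integrable[of unif2 f "\<lambda>_. 1"] sq_int_one[OF unif2.finite_measure_axioms] by simp

lemma legendre_bound: "\<exists>B. \<forall>i\<le>N. \<forall>x\<in>{0..1}. \<bar>poly (legendre i) x\<bar> \<le> B"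
proof -
  have "\<forall>i. \<exists>B. \<forall>x. 0 \<le> x \<longrightarrow> x \<le> 1 \<longrightarrow> \<bar>poly (legendre i) x\<bar> \<le> B"
    using poly_bounded_unit by blast
  then obtain B where B: "\<And>i x. 0 \<le> x \<Longrightarrow> x \<le> 1 \<Longrightarrow> \<bar>poly (legendre i) x\<bar> \<le> B i"
    by metis
  have "\<bar>poly (legendre i) x\<bar> \<le> (\<Sum>i\<le>N. B i)" if "i \<le> N" "x \<in> {0..1}" for i x
  proof -
    have "0 \<le> B k" for k using B[of 0 k] by simp
    then have "B i \<le> (\<Sum>i\<le>N. B i)" using that by (intro member_le_sum) auto
    then show ?thesis using B[of x i] that by simp
  qed
  then show ?thesis by blast
qed

lemma abs_integral_unif_le:
  fixes f :: "real \<Rightarrow> real"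
  assumes "f \<in> borel_measurable borel" "\<And>x. x \<in> {0..1} \<Longrightarrow> \<bar>f x\<bar> \<le> B"
  shows "\<bar>\<integral>x. f x \<partial>unif\<bar> \<le> B"
proof -
  have f: "integrable unif f" by (rule sq_int_unif_imp_integrable[OF sq_int_unif[OF assms]])
  have "\<bar>\<integral>x. f x \<partial>unif\<bar> \<le> (\<integral>x. \<bar>f x\<bar> \<partial>unif)" by (rule integral_abs_bound)
  also have "\<dots> \<le> (\<integral>x. B \<partial>unif)"
    using f assms by (intro integral_mono_AE AE_unifI) auto
  finally show ?thesis by simp
qed

text \<open>The tail of the tensor product expansion is controlled by the tails of the expansions of the
  slices: expand in the first variable, then apply Bessel's inequality in the first variable to
  the remainder of the expansion in the second variable.\<close>

lemma legendre_tail_2d: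
  fixes f :: "real \<times> real \<Rightarrow> real"
  assumes f_meas [measurable]: "f \<in> borel_measurable unif2" and f_bound: "\<And>z. \<bar>f z\<bar> \<le> 1"
    and tail1: "\<And>y. y \<in> {0..1} \<Longrightarrow> (\<integral>x. (f (x, y))\<^sup>2 \<partial>unif) -
      (\<Sum>i\<le>N. (\<integral>x. f (x, y) * poly (legendre i) x \<partial>unif)\<^sup>2) \<le> e"
    and tail2: "\<And>x. x \<in> {0..1} \<Longrightarrow> (\<integral>y. (f (x, y))\<^sup>2 \<partial>unif) -
      (\<Sum>j\<le>N. (\<integral>y. f (x, y) * poly (legendre j) y \<partial>unif)\<^sup>2) \<le> e"
  shows "(\<integral>z. (f z)\<^sup>2 \<partial>unif2) \<le>
    (\<Sum>i\<le>N. \<Sum>j\<le>N. (\<integral>z. f z * (poly (legendre i) (fst z) * poly (legendre j) (snd z)) \<partial>unif2)\<^sup>2) + 2 * e"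
proof -
  obtain B where B: "\<And>i x. i \<le> N \<Longrightarrow> x \<in> {0..1} \<Longrightarrow> \<bar>poly (legendre i) x\<bar> \<le> B"
    using legendre_bound by blast
  have B0: "B \<ge> 0" using B[of 0 0] by simp
  \<comment> \<open>\<open>g\<close> and \<open>h\<close> hold the coefficients in the first and in
    the second variable alone, as functions of the other variable.\<close>
  define g where "g i y = (\<integral>x. f (x, y) * poly (legendre i) x \<partial>unif)" for i y
  define h where "h j x = (\<integral>y. f (x, y) * poly (legendre j) y \<partial>unif)" for j x
  have [measurable]: "g i \<in> borel_measurable borel" "h i \<in> borel_measurable borel" for i
    unfolding g_def h_def by measurable
  have fB: "\<bar>f z * c\<bar> \<le> B" if "\<bar>c\<bar> \<le> B" for z c
    using mult_mono[OF f_bound[of z] that] by (simp add: abs_mult)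
  have gB: "\<bar>g i y\<bar> \<le> B" if "i \<le> N" for i y
    unfolding g_def by (intro abs_integral_unif_le fB B that) measurable
  have hB: "\<bar>h j x\<bar> \<le> B" if "j \<le> N" for j x
    unfolding h_def by (intro abs_integral_unif_le fB B that) measurable
  have g2: "sq_int unif (g i)" if "i \<le> N" for i using gB[OF that] by (intro sq_int_unif[of _ B]) auto
  have h2: "sq_int unif (h i)" if "i \<le> N" for i using hB[OF that] by (intro sq_int_unif[of _ B]) auto
  have fx: "sq_int unif (\<lambda>x. f (x, y))" for y by (intro sq_int_unif[of _ 1] f_bound) measurable
  have fy: "sq_int unif (\<lambda>y. f (x, y))" for x by (intro sq_int_unif[of _ 1] f_bound) measurable
  have f2: "sq_int unif2 f" by (intro sq_int_unif2[of _ 1] f_bound) measurable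
  define lam where "lam i j = (\<integral>x. h j x * poly (legendre i) x \<partial>unif)" for i j
  have int: "integrable unif2 (\<lambda>z. f z * (poly (legendre i) (fst z) * poly (legendre j) (snd z)))"
    if "i \<le> N" "j \<le> N" for i j
  proof (intro sq_int_unif2_imp_integrable sq_int_unif2[of _ "1 * (B * B)"])
    show "\<bar>f (x, y) * (poly (legendre i) (fst (x, y)) * poly (legendre j) (snd (x, y)))\<bar> \<le> 1 * (B * B)"
      if "x \<in> {0..1}" "y \<in> {0..1}" for x y
      unfolding abs_mult fst_conv snd_conv
      using B[OF \<open>i \<le> N\<close> that(1)] B[OF \<open>j \<le> N\<close> that(2)] f_bound[of "(x, y)"] B0
      by (intro mult_mono) auto
  qed measurable
  have lambda: "(\<integral>z. f z * (poly (legendre i) (fst z) * poly (legendre j) (snd z)) \<partial>unif2) = lam i j"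
    if "i \<le> N" "j \<le> N" for i j
  proof -
    have "(\<integral>z. f z * (poly (legendre i) (fst z) * poly (legendre j) (snd z)) \<partial>unif2) =
        (\<integral>x. \<integral>y. f (x, y) * (poly (legendre i) x * poly (legendre j) y) \<partial>unif \<partial>unif)"
      using unif2.integral_fst'[OF int[OF that]] by simp
    also have "\<dots> = (\<integral>x. \<integral>y. poly (legendre i) x * (f (x, y) * poly (legendre j) y) \<partial>unif \<partial>unif)"
      by (simp only: mult_ac)
    also have "\<dots> = lam i j"
      unfolding lam_def h_def by (simp only: integral_mult_right_zero mult.commute)
    finally show ?thesis .
  qed
  \<comment> \<open>By Fubini the double coefficients are those of \<open>g\<close> as well as those
    of \<open>h\<close>, which links the two expansions.\<close>
  have lambda': "(\<integral>y. g i y * poly (legendre j) y \<partial>unif) = lam i j" if "i \<le> N" "j \<le> N" for i j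
  proof -
    have "lam i j = (\<integral>y. \<integral>x. f (x, y) * (poly (legendre i) x * poly (legendre j) y) \<partial>unif \<partial>unif)"
      using unif2.integral_snd[of "\<lambda>x y. f (x, y) * (poly (legendre i) x * poly (legendre j) y)"] int[OF that] lambda[OF that]
      by (simp add: split_def)
    also have "\<dots> = (\<integral>y. \<integral>x. poly (legendre j) y * (f (x, y) * poly (legendre i) x) \<partial>unif \<partial>unif)"
      by (simp only: mult_ac)
    also have "\<dots> = (\<integral>y. g i y * poly (legendre j) y \<partial>unif)"
      unfolding g_def by (simp only: integral_mult_right_zero mult.commute)
    finally show ?thesis by simp
  qed
  \<comment> \<open>Integrating \<open>tail1\<close> over y costs the first
    \<open>e\<close>.\<close>
  have step1: "(\<integral>z. (f z)\<^sup>2 \<partial>unif2) \<le> (\<Sum>i\<le>N. \<integral>y. (g i y)\<^sup>2 \<partial>unif) + e"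
  proof -
    have gi: "integrable unif (\<lambda>y. (g i y)\<^sup>2)" if "i \<le> N" for i using g2[OF that] by (simp add: sq_int_def)
    have gs: "integrable unif (\<lambda>y. \<Sum>i\<le>N. (g i y)\<^sup>2)"
      by (rule Bochner_Integration.integrable_sum) (simp add: gi)
    have f2': "integrable unif2 (\<lambda>z. (f z)\<^sup>2)" using f2 by (simp add: sq_int_def)
    have "(\<integral>z. (f z)\<^sup>2 \<partial>unif2) = (\<integral>y. (\<integral>x. (f (x, y))\<^sup>2 \<partial>unif) \<partial>unif)"
      using unif2.integral_snd[of "\<lambda>x y. (f (x, y))\<^sup>2"] f2' by (simp add: split_def)
    also have "\<dots> \<le> (\<integral>y. (\<Sum>i\<le>N. (g i y)\<^sup>2) + e \<partial>unif)"
    proof (rule integral_mono_AE)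
      show "integrable unif (\<lambda>y. (\<integral>x. (f (x, y))\<^sup>2 \<partial>unif))"
        using unif2.integrable_snd[of "\<lambda>x y. (f (x, y))\<^sup>2"] f2' by (simp add: split_def)
      show "integrable unif (\<lambda>y. (\<Sum>i\<le>N. (g i y)\<^sup>2) + e)"
        by (simp add: gs)
      show "AE y in unif. (\<integral>x. (f (x, y))\<^sup>2 \<partial>unif) \<le> (\<Sum>i\<le>N. (g i y)\<^sup>2) + e"
        using tail1 by (intro AE_unifI) (auto simp: g_def algebra_simps)
    qed
    also have "\<dots> = (\<Sum>i\<le>N. \<integral>y. (g i y)\<^sup>2 \<partial>unif) + e"
      by (simp add: gs gi)
    finally show ?thesis .
  qed
  define R where "R z = f z - (\<Sum>j\<le>N. h j (fst z) * poly (legendre j) (snd z))" for z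
  have [measurable]: "R \<in> borel_measurable unif2" unfolding R_def by measurable
  have RB: "\<bar>R (x, y)\<bar> \<le> 1 + (\<Sum>j\<le>N. B * B)" if "y \<in> {0..1}" for x y
  proof -
    have "\<bar>R (x, y)\<bar> \<le> \<bar>f (x, y)\<bar> + (\<Sum>j\<le>N. \<bar>h j x * poly (legendre j) y\<bar>)"
      unfolding R_def fst_conv snd_conv by (rule order_trans[OF abs_triangle_ineq4]) simp
    also have "\<dots> \<le> 1 + (\<Sum>j\<le>N. B * B)"
      unfolding abs_mult using B[OF _ that] hB B0 by (intro add_mono sum_mono mult_mono f_bound) auto
    finally show ?thesis .
  qed
  have R2: "integrable unif2 (\<lambda>z. (R z)\<^sup>2)"
    using sq_int_unif2[of R] RB by (auto simp: sq_int_def)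
  \<comment> \<open>The second \<open>e\<close> will bound the total loss from truncating the
    expansions of all \<open>g i\<close>.\<close>
  have "(\<Sum>i\<le>N. (\<integral>y. (g i y)\<^sup>2 \<partial>unif) - (\<Sum>j\<le>N. (lam i j)\<^sup>2)) \<le>
      (\<Sum>i\<le>N. \<integral>y. (g i y - (\<Sum>j\<le>N. lam i j * poly (legendre j) y))\<^sup>2 \<partial>unif)"
  proof (rule sum_mono)
    fix i assume "i \<in> {..N}"
    then have "(\<integral>y. (g i y - (\<Sum>j\<le>N. lam i j * poly (legendre j) y))\<^sup>2 \<partial>unif) =
        (\<integral>y. (g i y)\<^sup>2 \<partial>unif) - (\<Sum>j\<le>N. (\<integral>y. g i y * poly (legendre j) y \<partial>unif)\<^sup>2) +
        (\<Sum>j\<le>N. (lam i j - (\<integral>y. g i y * poly (legendre j) y \<partial>unif))\<^sup>2)"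
      by (intro orthonormal_dist_squared sq_int_poly g2 legendre_orthonormal) auto
    moreover have "(\<integral>y. g i y * poly (legendre j) y \<partial>unif) = lam i j" if "j \<le> N" for j
      using lambda' \<open>i \<in> {..N}\<close> that by simp
    ultimately show "(\<integral>y. (g i y)\<^sup>2 \<partial>unif) - (\<Sum>j\<le>N. (lam i j)\<^sup>2) \<le>
      (\<integral>y. (g i y - (\<Sum>j\<le>N. lam i j * poly (legendre j) y))\<^sup>2 \<partial>unif)"
      by (auto simp: sum_nonneg)
  qed
  also have "\<dots> = (\<integral>y. (\<Sum>i\<le>N. (g i y - (\<Sum>j\<le>N. lam i j * poly (legendre j) y))\<^sup>2) \<partial>unif)"
  proof (rule Bochner_Integration.integral_sum[symmetric])
    fix i assume "i \<in> {..N}"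
    then have "sq_int unif (\<lambda>y. g i y - (\<Sum>j\<le>N. lam i j * poly (legendre j) y))"
      by (intro sq_int_diff g2 sq_int_sum sq_int_scale sq_int_poly) auto
    then show "integrable unif (\<lambda>y. (g i y - (\<Sum>j\<le>N. lam i j * poly (legendre j) y))\<^sup>2)"
      by (simp add: sq_int_def)
  qed
  also have "\<dots> \<le> (\<integral>y. (\<integral>x. (R (x, y))\<^sup>2 \<partial>unif) \<partial>unif)"
  proof (rule integral_mono_AE)
    show "integrable unif (\<lambda>y. \<integral>x. (R (x, y))\<^sup>2 \<partial>unif)"
      using unif2.integrable_snd[of "\<lambda>x y. (R (x, y))\<^sup>2"] R2 by (simp add: split_def)
    show "integrable unif (\<lambda>y. \<Sum>i\<le>N. (g i y - (\<Sum>j\<le>N. lam i j * poly (legendre j) y))\<^sup>2)"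
    proof (rule Bochner_Integration.integrable_sum)
      fix i assume "i \<in> {..N}"
      then have "sq_int unif (\<lambda>y. g i y - (\<Sum>j\<le>N. lam i j * poly (legendre j) y))"
        by (intro sq_int_diff g2 sq_int_sum sq_int_scale sq_int_poly) auto
      then show "integrable unif (\<lambda>y. (g i y - (\<Sum>j\<le>N. lam i j * poly (legendre j) y))\<^sup>2)"
        by (simp add: sq_int_def)
    qed
    show "AE y in unif. (\<Sum>i\<le>N. (g i y - (\<Sum>j\<le>N. lam i j * poly (legendre j) y))\<^sup>2) \<le> (\<integral>x. (R (x, y))\<^sup>2 \<partial>unif)"
    proof (rule AE_unifI)
      fix y :: real assume y: "0 \<le> y" "y \<le> 1"
      have Ry: "sq_int unif (\<lambda>x. R (x, y))"
        using RB y by (intro sq_int_unif[of _ "1 + (\<Sum>j\<le>N. B * B)"]) auto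
      \<comment> \<open>Projections in different variables commute: the coefficients of the
        remainder are the remainders of the coefficients.\<close>
      have "(\<integral>x. R (x, y) * poly (legendre i) x \<partial>unif) = g i y - (\<Sum>j\<le>N. lam i j * poly (legendre j) y)" for i
      proof -
        have "(\<integral>x. R (x, y) * poly (legendre i) x \<partial>unif) =
          (\<integral>x. f (x, y) * poly (legendre i) x - (\<Sum>j\<le>N. poly (legendre j) y * (h j x * poly (legendre i) x)) \<partial>unif)"
          unfolding R_def fst_conv snd_conv left_diff_distrib sum_distrib_right by (simp add: mult_ac)
        also have "\<dots> = g i y - (\<Sum>j\<le>N. poly (legendre j) y * lam i j)"
          unfolding g_def lam_def
          using sq_int_mult_integrable[OF fx sq_int_poly] sq_int_mult_integrable[OF h2 sq_int_poly]
          by (subst Bochner_Integration.integral_diff) auto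
        finally show ?thesis by (simp add: mult.commute)
      qed
      then show "(\<Sum>i\<le>N. (g i y - (\<Sum>j\<le>N. lam i j * poly (legendre j) y))\<^sup>2) \<le> (\<integral>x. (R (x, y))\<^sup>2 \<partial>unif)"
        using bessel_inequality[of "{..N}" unif "\<lambda>i. poly (legendre i)", OF _ sq_int_poly Ry legendre_orthonormal]
        by simp
    qed
  qed
  also have "\<dots> = (\<integral>x. (\<integral>y. (R (x, y))\<^sup>2 \<partial>unif) \<partial>unif)"
    using unif2.Fubini_integral[of "\<lambda>x y. (R (x, y))\<^sup>2"] R2 by (simp add: split_def)
  also have "\<dots> \<le> (\<integral>x. e \<partial>unif)"
  proof (rule integral_mono_AE)
    show "integrable unif (\<lambda>x. \<integral>y. (R (x, y))\<^sup>2 \<partial>unif)"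
      using unif2.integrable_fst[of "\<lambda>x y. (R (x, y))\<^sup>2"] R2 by (simp add: split_def)
    show "AE x in unif. (\<integral>y. (R (x, y))\<^sup>2 \<partial>unif) \<le> e"
    proof (rule AE_unifI)
      fix x :: real assume x: "0 \<le> x" "x \<le> 1"
      have "(\<integral>y. (R (x, y))\<^sup>2 \<partial>unif) = (\<integral>y. (f (x, y))\<^sup>2 \<partial>unif) - (\<Sum>j\<le>N. (h j x)\<^sup>2)"
        unfolding R_def fst_conv snd_conv
        using orthonormal_dist_squared[of "{..N}" unif "\<lambda>i. poly (legendre i)", OF _ sq_int_poly fy legendre_orthonormal]
        by (simp add: h_def)
      then show "(\<integral>y. (R (x, y))\<^sup>2 \<partial>unif) \<le> e" using tail2[of x] x by (simp add: h_def)
    qed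
  qed simp
  finally have "(\<Sum>i\<le>N. \<integral>y. (g i y)\<^sup>2 \<partial>unif) \<le> (\<Sum>i\<le>N. \<Sum>j\<le>N. (lam i j)\<^sup>2) + e"
    by (simp add: sum_subtractf)
  then show ?thesis using step1 lambda by simp
qed

section \<open>Inscribed polygons\<close>

text \<open>A bridge from pairs, where product measures and Fubini are available, to
  \<open>real^2\<close>.\<close>

definition vec2 :: "real \<times> real \<Rightarrow> real^2" where
  "vec2 z = fst z *\<^sub>R axis 1 1 + snd z *\<^sub>R axis 2 1"

lemma vec2_nth [simp]: "vec2 z $ 1 = fst z" "vec2 z $ 2 = snd z"
  by (simp_all add: vec2_def axis_def)

lemma vec2_components: "vec2 (v $ 1, v $ 2) = v"
  by (simp add: vec_eq_iff forall_2)

lemma vec2_combine: "a *\<^sub>R vec2 (x, y) + b *\<^sub>R vec2 (x', y') = vec2 (a * x + b * x', a * y + b * y')"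
  by (simp add: vec_eq_iff forall_2)

lemma continuous_on_vec2 [continuous_intros]: "continuous_on S vec2"
  unfolding vec2_def by (intro continuous_intros)

lemma measurable_vec2 [measurable]: "vec2 \<in> borel_measurable borel"
  by (intro borel_measurable_continuous_onI continuous_on_vec2)

lemma vec2_mem_unit_square: "vec2 (x, y) \<in> unit_square \<longleftrightarrow> x \<in> {0..1} \<and> y \<in> {0..1}"
  by (auto simp: mem_box_cart forall_2)

text \<open>Lebesgue measure is determined by its values on boxes, and preimages of boxes under
  \<open>vec2\<close> are products of intervals.\<close>

lemma lborel_vec2: "lborel = distr lborel borel vec2"
proof (rule lborel_eqI)
  fix l u :: "real^2" assume lu: "\<And>b. b \<in> Basis \<Longrightarrow> l \<bullet> b \<le> u \<bullet> b"
  have B: "Basis = {axis 1 1, axis 2 1 :: real^2}"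
    by (auto simp: Basis_vec_def UNIV_2)
  have le: "l $ 1 \<le> u $ 1" "l $ 2 \<le> u $ 2"
    using lu[of "axis 1 1"] lu[of "axis 2 1"] by (simp_all add: B inner_axis)
  have "vec2 -` box l u = {l $ 1<..<u $ 1} \<times> {l $ 2<..<u $ 2}"
    by (auto simp: mem_box_cart forall_2)
  then have "emeasure (distr lborel borel vec2) (box l u) = emeasure (lborel \<Otimes>\<^sub>M lborel) ({l $ 1<..<u $ 1} \<times> {l $ 2<..<u $ 2})"
    by (subst emeasure_distr) (auto simp: lborel_prod)
  also have "\<dots> = ennreal ((u $ 1 - l $ 1) * (u $ 2 - l $ 2))"
    using le by (subst lborel.emeasure_pair_measure_Times) (auto simp: ennreal_mult)
  also have "(u $ 1 - l $ 1) * (u $ 2 - l $ 2) = (\<Prod>b\<in>Basis. (u - l) \<bullet> b)"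
    by (simp add: B axis_eq_axis inner_axis)
  finally show "emeasure (distr lborel borel vec2) (box l u) = (\<Prod>b\<in>Basis. (u - l) \<bullet> b)" .
qed simp

section \<open>Slices of planar convex sets\<close>

definition slice :: "(real^2) set \<Rightarrow> real \<Rightarrow> real set" where
  "slice C x = {y. vec2 (x, y) \<in> C}"

definition slice_length :: "(real^2) set \<Rightarrow> real \<Rightarrow> real" where
  "slice_length C x = measure lborel (slice C x)"

lemma slice_length_nonneg [simp]: "slice_length C x \<ge> 0"
  by (simp add: slice_length_def)

lemma compact_section:
  fixes C :: "(real^'n) set"
  assumes "compact C" shows "compact ((\<lambda>v. v $ j) ` (C \<inter> {v. v $ i = c}))"
  by (intro compact_continuous_image compact_Int_closed closed_Collect_eq continuous_intros assms)

lemma convex_section: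
  fixes C :: "(real^'n) set"
  assumes "convex C" shows "convex ((\<lambda>v. v $ j) ` (C \<inter> {v. v $ i = c}))"
proof (intro convex_linear_image convex_Int assms)
  show "linear (\<lambda>v :: real^'n. v $ j)" by (rule bounded_linear.linear[OF bounded_linear_vec_nth])
  show "convex {v :: real^'n. v $ i = c}"
    by (auto simp: convex_def simp flip: distrib_right)
qed

lemma slice_eq_section: "slice C x = (\<lambda>v. v $ 2) ` (C \<inter> {v. v $ 1 = x})"
  by (force simp: slice_def image_iff vec2_components intro: bexI[of _ "vec2 (x, y)" for y])

lemma horizontal_slice_eq_section: "{x. vec2 (x, y) \<in> C} = (\<lambda>v. v $ 1) ` (C \<inter> {v. v $ 2 = y})"
  by (force simp: image_iff vec2_components intro: bexI[of _ "vec2 (x, y)" for x])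

lemma compact_slice: "compact C \<Longrightarrow> compact (slice C x)"
  unfolding slice_eq_section by (rule compact_section)

lemma convex_slice: "convex C \<Longrightarrow> convex (slice C x)"
  unfolding slice_eq_section by (rule convex_section)

lemma slice_eq_interval:
  assumes "compact C" "convex C"
  obtains a b where "slice C x = {a..b}"
proof -
  have "connected (slice C x) \<and> compact (slice C x)"
    using convex_connected convex_slice compact_slice assms by blast
  then show ?thesis using that unfolding connected_compact_interval_1 by blast
qed

lemma slice_subset_unit: "C \<subseteq> unit_square \<Longrightarrow> slice C x \<subseteq> {0..1}"
  using vec2_mem_unit_square by (auto simp: slice_def)

lemma slice_length_mono:
  assumes "compact C" "slice D x \<subseteq> slice C x" "compact D" shows "slice_length D x \<le> slice_length C x"
  unfolding slice_length_def using assms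
  by (intro measure_mono_fmeasurable) (auto intro: fmeasurable_compact compact_slice borel_compact)

text \<open>One-dimensional Brunn-Minkowski: convex combinations of the lower and of the upper end
  points stay in the intermediate slice. Both slices must be nonempty, as the length may jump to 0
  at the boundary of the projection.\<close>

lemma slice_length_concave:
  assumes C: "compact C" "convex C" and ne: "slice C u \<noteq> {}" "slice C v \<noteq> {}" and t: "0 \<le> t" "t \<le> 1"
  shows "(1 - t) * slice_length C u + t * slice_length C v \<le> slice_length C ((1 - t) * u + t * v)"
proof -
  obtain a b where u: "slice C u = {a..b}" using slice_eq_interval[OF C] .
  obtain c d where v: "slice C v = {c..d}" using slice_eq_interval[OF C] .
  have ab: "a \<le> b" "c \<le> d" using ne u v by auto
  let ?x = "(1 - t) * u + t * v"
  obtain e f where x: "slice C ?x = {e..f}" using slice_eq_interval[OF C] .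
  have comb: "(1 - t) * y + t * z \<in> slice C ?x" if "y \<in> slice C u" "z \<in> slice C v" for y z
  proof -
    have "(1 - t) *\<^sub>R vec2 (u, y) + t *\<^sub>R vec2 (v, z) \<in> C"
      using that t C(2) by (auto simp: slice_def convex_alt)
    then show ?thesis by (simp add: vec2_combine slice_def)
  qed
  have "e \<le> (1 - t) * a + t * c" using comb[of a c] ab u v x by auto
  moreover have "(1 - t) * b + t * d \<le> f" using comb[of b d] ab u v x by auto
  moreover have "(1 - t) * a + t * c \<le> (1 - t) * b + t * d"
    using ab t by (intro add_mono mult_left_mono) auto
  ultimately have "(1 - t) * (b - a) + t * (d - c) \<le> f - e" "e \<le> f"
    by (simp_all add: algebra_simps)
  then show ?thesis
    unfolding slice_length_def u v x using ab by simp
qed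

lemma area_eq_integral_slice_length:
  assumes "compact C" "C \<subseteq> unit_square"
  shows "integrable lborel (slice_length C)" "measure lborel C = (\<integral>x. slice_length C x \<partial>lborel)"
proof -
  have C [measurable]: "C \<in> sets borel" using assms by (auto intro: borel_compact)
  have V: "vec2 -` C \<in> sets (lborel \<Otimes>\<^sub>M lborel)"
    unfolding lborel_prod using measurable_sets[OF measurable_vec2 C] by simp
  have pre: "Pair x -` (vec2 -` C) = slice C x" for x by (auto simp: slice_def)
  have em: "emeasure lborel C = (\<integral>\<^sup>+x. emeasure lborel (slice C x) \<partial>lborel)"
  proof -
    have "emeasure lborel C = emeasure (lborel \<Otimes>\<^sub>M lborel) (vec2 -` C)"
      by (subst lborel_vec2, subst emeasure_distr) (auto simp: lborel_prod)
    also have "\<dots> = (\<integral>\<^sup>+x. emeasure lborel (Pair x -` (vec2 -` C)) \<partial>lborel)"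
      by (rule lborel.emeasure_pair_measure_alt[OF V])
    finally show ?thesis by (simp only: pre)
  qed
  have sl: "emeasure lborel (slice C x) = ennreal (slice_length C x)" for x
    unfolding slice_length_def
    using emeasure_compact_finite[OF compact_slice[OF assms(1)], of x]
    by (intro emeasure_eq_ennreal_measure) (simp add: less_top)
  have meas: "slice_length C \<in> borel_measurable lborel"
  proof -
    have "(\<lambda>x. emeasure lborel (Pair x -` (vec2 -` C))) \<in> borel_measurable lborel"
      by (rule lborel.measurable_emeasure_Pair[OF V])
    then have "(\<lambda>x. enn2real (emeasure lborel (slice C x))) \<in> borel_measurable lborel" by (simp add: pre)
    then show ?thesis by (simp add: sl)
  qed
  have fin: "emeasure lborel C < \<infinity>" by (rule emeasure_compact_finite[OF assms(1)])
  show int: "integrable lborel (slice_length C)"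
    by (rule integrableI_nonneg[OF meas]) (use fin em sl in auto)
  have "emeasure lborel C = ennreal (\<integral>x. slice_length C x \<partial>lborel)"
    unfolding em sl by (rule nn_integral_eq_integral[OF int]) auto
  then show "measure lborel C = (\<integral>x. slice_length C x \<partial>lborel)"
    by (simp add: measure_def)
qed

section \<open>Trapezoid sums of slice lengths\<close>

lemma set_integral_partition:
  fixes f :: "real \<Rightarrow> real" and X :: "nat \<Rightarrow> real"
  assumes "\<And>i. i < n \<Longrightarrow> X i \<le> X (Suc i)" "set_integrable lborel {X 0..X n} f"
  shows "(LINT x:{X 0..X n}|lborel. f x) = (\<Sum>i<n. LINT x:{X i..X (Suc i)}|lborel. f x)"
  using assms
proof (induction n)
  case 0
  have "(LINT x:{X 0..X 0}|lborel. f x) = 0"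
    unfolding set_lebesgue_integral_def
  proof (rule integral_eq_zero_AE)
    have "AE x in lborel. x \<noteq> X 0" by (rule AE_lborel_singleton)
    then show "AE x in lborel. indicator {X 0..X 0} x *\<^sub>R f x = 0"
      by eventually_elim auto
  qed
  then show ?case by simp
next
  case (Suc n)
  have le: "X 0 \<le> X i" if "i \<le> Suc n" for i
    using that
  proof (induction i)
    case (Suc i) then show ?case using Suc.prems \<open>\<And>i. i < Suc n \<Longrightarrow> X i \<le> X (Suc i)\<close>[of i] by simp
  qed simp
  have un: "{X 0..X (Suc n)} = {X 0..X n} \<union> {X n..X (Suc n)}"
    using le[of n] Suc.prems(1)[of n] by auto
  have si: "set_integrable lborel {X 0..X n} f" "set_integrable lborel {X n..X (Suc n)} f"
    using le[of n] Suc.prems(1)[of n] by (auto intro: set_integrable_subset[OF Suc.prems(2)])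
  have "(LINT x:{X 0..X (Suc n)}|lborel. f x) =
      (LINT x:{X 0..X n}|lborel. f x) + (LINT x:{X n..X (Suc n)}|lborel. f x)"
    unfolding un
  proof (rule set_integral_Un_AE)
    have "AE x in lborel. x \<noteq> X n" by (rule AE_lborel_singleton)
    then show "AE x in lborel. \<not> (x \<in> {X 0..X n} \<and> x \<in> {X n..X (Suc n)})"
      by eventually_elim auto
  qed (use si in auto)
  then show ?case using Suc.IH[OF Suc.prems(1) si(1)] by simp
qed

lemma set_integrable_lborelI:
  fixes f :: "real \<Rightarrow> real"
  shows "integrable lborel f \<Longrightarrow> A \<in> sets borel \<Longrightarrow> set_integrable lborel A f"
  unfolding set_integrable_def using integrable_mult_indicator[of A lborel f] by simp

text \<open>A concave function lies above its chord, and the trapezoid is the integral of the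
  chord.\<close>

lemma trapezoid_le_integral_slice_length:
  assumes C: "compact C" "convex C" "C \<subseteq> unit_square"
    and ne: "slice C u \<noteq> {}" "slice C v \<noteq> {}" and uv: "u \<le> v"
  shows "(v - u) * (slice_length C u + slice_length C v) / 2 \<le> (LINT x:{u..v}|lborel. slice_length C x)"
proof (cases "u = v")
  case True
  then show ?thesis
    unfolding set_lebesgue_integral_def by (auto intro!: integral_nonneg_AE)
next
  case False
  with uv have uv: "u < v" by simp
  define p q s where "p = slice_length C u" and "q = slice_length C v" and "s = (q - p) / (v - u)"
  have sv: "s * (v - u) = q - p" using uv by (simp add: s_def)
  have deriv: "((\<lambda>x. p * x + s * (x - u)\<^sup>2 / 2) has_real_derivative p + s * (x - u)) (at x within {u..v})" for x
    by (rule derivative_eq_intros refl | simp)+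
  have cont: "continuous_on {u..v} (\<lambda>x. p + s * (x - u))" by (intro continuous_intros)
  have "(LINT x:{u..v}|lborel. p + s * (x - u)) = (p * v + s * (v - u)\<^sup>2 / 2) - (p * u + s * (u - u)\<^sup>2 / 2)"
    unfolding set_lebesgue_integral_def
    using integral_FTC_Icc[OF less_imp_le[OF uv] _ cont, of "\<lambda>x. p * x + s * (x - u)\<^sup>2 / 2"] deriv
    unfolding has_real_derivative_iff_has_vector_derivative by blast
  also have "\<dots> = (v - u) * p + (v - u) * (s * (v - u)) / 2"
    by (simp add: power2_eq_square algebra_simps)
  also have "\<dots> = (v - u) * (p + q) / 2"
    unfolding sv by (simp add: field_simps)
  finally have "(v - u) * (p + q) / 2 = (LINT x:{u..v}|lborel. p + s * (x - u))" by simp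
  also have "\<dots> \<le> (LINT x:{u..v}|lborel. slice_length C x)"
  proof (rule set_integral_mono)
    show "set_integrable lborel {u..v} (\<lambda>x. p + s * (x - u))"
      by (rule borel_integrable_atLeastAtMost'[OF cont])
    show "set_integrable lborel {u..v} (slice_length C)"
      by (intro set_integrable_lborelI area_eq_integral_slice_length C) auto
    fix x assume x: "x \<in> {u..v}"
    define t where "t = (x - u) / (v - u)"
    have t: "0 \<le> t" "t \<le> 1" using x uv by (auto simp: t_def)
    have tv: "t * (v - u) = x - u" using uv by (simp add: t_def)
    have "p + s * (x - u) = (1 - t) * p + t * q"
      using sv tv by (metis (no_types, opaque_lifting) add_diff_eq diff_add_eq left_diff_distrib mult.assoc mult.commute mult_1 right_diff_distrib)
    also have "\<dots> \<le> slice_length C ((1 - t) * u + t * v)"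
      unfolding p_def q_def by (rule slice_length_concave[OF C(1,2) ne t])
    also have "(1 - t) * u + t * v = x" using tv by (simp add: algebra_simps)
    finally show "p + s * (x - u) \<le> slice_length C x" .
  qed
  finally show ?thesis by (simp add: p_def q_def)
qed

text \<open>Collected by nodes, the trapezoid sum weights each inner node by half the distance
  between its neighbours; the two end nodes contribute nonnegative terms, which are dropped.\<close>

lemma trapezoid_sum_ge:
  fixes X l :: "nat \<Rightarrow> real"
  assumes X: "\<And>i. i \<le> k \<Longrightarrow> X i \<le> X (Suc i)" and l: "\<And>i. l i \<ge> 0"
  shows "(\<Sum>i<k. l (Suc i) * (X (Suc (Suc i)) - X i) / 2) \<le>
    (\<Sum>i<Suc k. (X (Suc i) - X i) * (l i + l (Suc i)) / 2)"
proof -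
  let ?d = "\<lambda>i. X (Suc i) - X i"
  have "(\<Sum>i<k. ?d (Suc i) * l (Suc i)) \<le> (\<Sum>i<Suc k. ?d i * l i)"
    unfolding sum.lessThan_Suc_shift using X[of 0] l[of 0] by simp
  moreover have "(\<Sum>i<k. ?d i * l (Suc i)) \<le> (\<Sum>i<Suc k. ?d i * l (Suc i))"
    using X[of k] l[of "Suc k"] by simp
  moreover have "(\<Sum>i<k. l (Suc i) * (X (Suc (Suc i)) - X i)) = (\<Sum>i<k. ?d (Suc i) * l (Suc i)) + (\<Sum>i<k. ?d i * l (Suc i))"
    by (simp add: sum.distrib[symmetric] algebra_simps)
  moreover have "(\<Sum>i<Suc k. ?d i * (l i + l (Suc i))) = (\<Sum>i<Suc k. ?d i * l i) + (\<Sum>i<Suc k. ?d i * l (Suc i))"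
    by (simp only: distrib_left sum.distrib)
  ultimately show ?thesis unfolding sum_divide_distrib[symmetric] by linarith
qed

lemma sin_ge_cubic: "0 \<le> x \<Longrightarrow> x - x ^ 3 / 6 \<le> sin x" for x :: real
  using Maclaurin_sin_bound[of x 3]
  by (simp add: numeral_3_eq_3 sin_coeff_def abs_if split: if_splits)

lemma measure_le_1_unit_square:
  assumes "compact C" "C \<subseteq> unit_square" shows "measure lborel C \<le> 1"
proof -
  have "measure lborel C \<le> measure lborel unit_square"
    using assms by (intro measure_mono_fmeasurable) (auto intro: borel_compact fmeasurable_compact)
  also have "measure lborel unit_square = 1"
    by (subst content_cbox_cart) (auto simp: interval_ne_empty_cart)
  finally show ?thesis .
qed

text \<open>If \<open>f\<close> stayed below \<open>A / h\<close>, its integral would be at most A;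
  with the strict hypothesis, plain monotonicity of the integral is already a contradiction.\<close>

lemma exists_ge_average:
  fixes f :: "real \<Rightarrow> real"
  assumes "0 < h" "set_integrable lborel {0..h} f" "A < (LINT t:{0..h}|lborel. f t)"
  shows "\<exists>t\<in>{0..h}. A / h \<le> f t"
proof (rule ccontr)
  assume *: "\<not> ?thesis"
  have "(LINT t:{0..h}|lborel. f t) \<le> (LINT t:{0..h}|lborel. A / h)"
    using * by (intro set_integral_mono assms(2)) (auto simp: not_le less_imp_le intro!: borel_integrable_atLeastAtMost')
  also have "\<dots> = A" using assms(1) by (simp add: set_lebesgue_integral_def)
  finally show False using assms(3) by simp
qed

text \<open>The vertices are the end points of the slices at \<open>c - r * cos (t + i * h)\<close> with \<open>h = pi / k\<close>.
  The area of the polygon is at least a trapezoid sum of the slice lengths of \<open>K\<close>, whose average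
  over the offset \<open>t\<close> is at least \<open>sin h / h\<close> times the area of \<open>K\<close>.\<close>

lemma inscribed_polygon:
  assumes K: "compact K" "convex K" "K \<subseteq> unit_square" "K \<noteq> {}" and k: "k \<ge> 1"
  shows "\<exists>S. finite S \<and> card S \<le> 2 * (k + 2) \<and> S \<noteq> {} \<and> S \<subseteq> K \<and>
    measure lborel K - measure lborel (convex hull S) \<le> 2 * (pi / real k)\<^sup>2"
proof -
  have "connected ((\<lambda>v. v $ 1) ` K) \<and> compact ((\<lambda>v. v $ 1) ` K)"
    using K by (intro conjI connected_continuous_image compact_continuous_image continuous_intros convex_connected)
  then obtain \<alpha> \<beta> where proj: "(\<lambda>v. v $ 1) ` K = {\<alpha>..\<beta>}"
    unfolding connected_compact_interval_1 by blast
  have ab: "\<alpha> \<le> \<beta>" using K(4) proj by (metis atLeastatMost_empty_iff2 image_is_empty not_le)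
  have slice_ne: "slice K x \<noteq> {} \<longleftrightarrow> x \<in> {\<alpha>..\<beta>}" for x
  proof
    assume "slice K x \<noteq> {}"
    then obtain y where "vec2 (x, y) \<in> K" by (auto simp: slice_def)
    then have "vec2 (x, y) $ 1 \<in> (\<lambda>v. v $ 1) ` K" by (rule imageI)
    then show "x \<in> {\<alpha>..\<beta>}" unfolding proj by simp
  next
    assume "x \<in> {\<alpha>..\<beta>}"
    then obtain v where "v \<in> K" "x = v $ 1" unfolding proj[symmetric] by auto
    then have "v $ 2 \<in> slice K x" by (simp add: slice_def vec2_components)
    then show "slice K x \<noteq> {}" by auto
  qed
  define h c r where "h = pi / real k" and "c = (\<alpha> + \<beta>) / 2" and "r = (\<beta> - \<alpha>) / 2"
  have h: "h > 0" "real k * h = pi" using k by (auto simp: h_def)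
  have r: "r \<ge> 0" "c - r = \<alpha>" "c + r = \<beta>" using ab by (auto simp: c_def r_def field_simps)
  have node: "c - r * cos t \<in> {\<alpha>..\<beta>}" for t
  proof -
    have "r * cos t \<le> r * 1" "r * (-1) \<le> r * cos t" using r(1) by (intro mult_left_mono; simp)+
    then show ?thesis using r by simp
  qed
  \<comment> \<open>The integrand of the area of \<open>K\<close> after the substitution
    \<open>x = c - r * cos t\<close>.\<close>
  define F where "F t = slice_length K (c - r * cos t) * (r * sin t)" for t
  note intK = area_eq_integral_slice_length[OF K(1,3)]
  have si: "set_integrable lborel {c - r * cos 0..c - r * cos pi} (slice_length K)"
    by (intro set_integrable_lborelI intK) auto
  have deriv: "((\<lambda>t. c - r * cos t) has_real_derivative r * sin t) (at t)" for t
    by (rule derivative_eq_intros refl | simp)+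
  have contd: "continuous_on {0..pi} (\<lambda>t. r * sin t)" by (intro continuous_intros)
  have nnd: "0 \<le> r * sin t" if "t \<in> {0..pi}" for t using that r(1) by (auto intro!: mult_nonneg_nonneg sin_ge_zero)
  have siF: "set_integrable lborel {0..pi} F"
    unfolding F_def by (rule integral_substitution(1)[OF si deriv contd nnd]) auto
  have "measure lborel K = (LINT x|lborel. slice_length K x * indicator {c - r * cos 0..c - r * cos pi} x)"
    unfolding intK(2)
  proof (rule Bochner_Integration.integral_cong)
    show "slice_length K x = slice_length K x * indicator {c - r * cos 0..c - r * cos pi} x" for x
      using slice_ne[of x] r by (cases "x \<in> {\<alpha>..\<beta>}") (auto simp: slice_length_def)
  qed simp
  also have "\<dots> = (LINT t|lborel. F t * indicator {0..pi} t)"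
    unfolding F_def using integral_substitution(2)[OF si deriv contd nnd] by (simp add: mult.assoc)
  also have "\<dots> = (LINT t:{real 0 * h..real k * h}|lborel. F t)"
    unfolding set_lebesgue_integral_def h(2) by (simp add: mult.commute)
  \<comment> \<open>Shifting the k pieces of [0, pi] onto [0, h] turns the area into an integral,
    over the offset t, of sums over equally spaced angles.\<close>
  also have "\<dots> = (\<Sum>i<k. LINT t:{real i * h..real (Suc i) * h}|lborel. F t)"
  proof (rule set_integral_partition[of k "\<lambda>i. real i * h" F])
    show "real i * h \<le> real (Suc i) * h" for i using h by (simp add: algebra_simps)
    show "set_integrable lborel {real 0 * h..real k * h} F" using siF h(2) by simp
  qed
  also have "\<dots> = (\<Sum>i<k. LINT t:{0..h}|lborel. F (t + real i * h))"
  proof (intro sum.cong refl)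
    fix i
    have "(LINT t:{real i * h..real (Suc i) * h}|lborel. F t) =
        (LINT t|lborel. indicator {real i * h..real (Suc i) * h} (real i * h + t) *\<^sub>R F (real i * h + t))"
      unfolding set_lebesgue_integral_def
      by (subst lborel_integral_real_affine[where c = 1 and t = "real i * h"]) auto
    also have "\<dots> = (LINT t:{0..h}|lborel. F (t + real i * h))"
      unfolding set_lebesgue_integral_def
      by (rule Bochner_Integration.integral_cong) (auto simp: indicator_def algebra_simps)
    finally show "(LINT t:{real i * h..real (Suc i) * h}|lborel. F t) = (LINT t:{0..h}|lborel. F (t + real i * h))" .
  qed
  finally have area1: "measure lborel K = (\<Sum>i<k. LINT t:{0..h}|lborel. F (t + real i * h))" .
  have siFi: "set_integrable lborel {0..h} (\<lambda>t. F (t + real i * h))" if "i < k" for i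
  proof -
    have le: "real i * h + h \<le> pi"
    proof -
      have "real (Suc i) * h \<le> real k * h" using that h by (intro mult_right_mono) auto
      then show ?thesis using h by (simp add: algebra_simps)
    qed
    have "set_integrable lborel {real i * h..real i * h + h} F"
      using le h by (intro set_integrable_subset[OF siF]) auto
    then have "integrable lborel (\<lambda>t. indicator {real i * h..real i * h + h} (real i * h + 1 * t) *\<^sub>R F (real i * h + 1 * t))"
      unfolding set_integrable_def by (rule lborel_integrable_real_affine) simp
    moreover have "indicator {real i * h..real i * h + h} (real i * h + 1 * t) *\<^sub>R F (real i * h + 1 * t) =
        indicator {0..h} t *\<^sub>R F (t + real i * h)" for t
      by (auto simp: indicator_def algebra_simps)
    ultimately show ?thesis unfolding set_integrable_def by simp
  qed
  have siS: "set_integrable lborel {0..h} (\<lambda>t. \<Sum>i<k. F (t + real i * h))"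
    unfolding set_integrable_def scaleR_sum_right
    by (rule Bochner_Integration.integrable_sum) (use siFi in \<open>auto simp: set_integrable_def\<close>)
  have area2: "measure lborel K = (LINT t:{0..h}|lborel. \<Sum>i<k. F (t + real i * h))"
    unfolding area1 set_lebesgue_integral_def scaleR_sum_right
    by (rule Bochner_Integration.integral_sum[symmetric]) (use siFi in \<open>auto simp: set_integrable_def\<close>)
  \<comment> \<open>Giving up \<open>h\<^sup>2\<close> makes the comparison with the average strict,
    as \<open>exists_ge_average\<close> demands.\<close>
  have "\<exists>t\<in>{0..h}. (measure lborel K - h\<^sup>2) / h \<le> (\<Sum>i<k. F (t + real i * h))"
    using h siS area2 by (intro exists_ge_average) auto
  then obtain t where t: "0 \<le> t" "t \<le> h" and t_avg: "(measure lborel K - h\<^sup>2) / h \<le> (\<Sum>i<k. F (t + real i * h))"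
    by auto
  \<comment> \<open>The ends of the projection join the k inner nodes as X 0 and X (k + 1); two
    points on each of these k + 2 slices give the bound on \<open>card S\<close>.\<close>
  define X where "X i = (if i = 0 then \<alpha> else if i \<le> k then c - r * cos (t + (real i - 1) * h) else \<beta>)" for i :: nat
  have X_in: "X i \<in> {\<alpha>..\<beta>}" for i using node ab by (auto simp: X_def)
  have angle: "0 \<le> t + real i * h" "t + real i * h \<le> pi" if "i < k" for i
  proof -
    show "0 \<le> t + real i * h" using t h by simp
    have "real (Suc i) * h \<le> real k * h" using that h by (intro mult_right_mono) auto
    then show "t + real i * h \<le> pi" using t h by (simp add: algebra_simps)
  qed
  have X_mono: "X i \<le> X (Suc i)" if "i \<le> k" for i
  proof -
    consider "i = 0" | "i = k" | "0 < i" "i < k"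
      using \<open>i \<le> k\<close> by (metis le_neq_implies_less neq0_conv)
    then show ?thesis
    proof cases
      case 1 then show ?thesis using X_in[of "Suc i"] by (simp add: X_def)
    next
      case 2 then show ?thesis using X_in[of i] by (simp add: X_def)
    next
      case 3
      then obtain j where j: "i = Suc j" by (cases i) auto
      have "cos (t + real i * h) \<le> cos (t + real j * h)"
        using 3 j h angle[of i] angle[of j] by (intro cos_monotone_0_pi_le) (auto intro!: mult_right_mono)
      then show ?thesis using 3 j r(1) by (auto simp: X_def intro!: mult_left_mono)
    qed
  qed
  \<comment> \<open>The neighbours of an inner node have its angle shifted by -h and h, or are ends
    of the projection, which lie at least as far out. The difference of the shifted cosines is the
    product on the left.\<close>
  have X_diff: "2 * (r * sin (t + real i * h)) * sin h \<le> X (Suc (Suc i)) - X i" if "i < k" for i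
  proof -
    let ?th = "t + real i * h"
    have "c - r * cos (?th + h) \<le> X (Suc (Suc i))"
    proof (cases "Suc (Suc i) \<le> k")
      case True
      have "t + (real (Suc (Suc i)) - 1) * h = ?th + h" by (simp add: algebra_simps)
      moreover have "X (Suc (Suc i)) = c - r * cos (t + (real (Suc (Suc i)) - 1) * h)"
        using True by (simp add: X_def)
      ultimately show ?thesis by (simp only: order_refl)
    next
      case False
      then show ?thesis using node[of "?th + h"] by (simp add: X_def)
    qed
    moreover have "X i \<le> c - r * cos (?th - h)"
    proof (cases "i = 0")
      case True
      then show ?thesis using node[of "?th - h"] by (simp add: X_def)
    next
      case False
      have "t + (real i - 1) * h = ?th - h" by (simp add: algebra_simps)
      moreover have "X i = c - r * cos (t + (real i - 1) * h)"
        using False that by (simp add: X_def)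
      ultimately show ?thesis by (simp only: order_refl)
    qed
    ultimately have "(c - r * cos (?th + h)) - (c - r * cos (?th - h)) \<le> X (Suc (Suc i)) - X i" by linarith
    moreover have "(c - r * cos (?th + h)) - (c - r * cos (?th - h)) = 2 * (r * sin ?th) * sin h"
      by (simp add: cos_add cos_diff right_diff_distrib distrib_left)
    ultimately show ?thesis by simp
  qed
  define S where "S = (\<lambda>i. vec2 (X i, Inf (slice K (X i)))) ` {..Suc k} \<union> (\<lambda>i. vec2 (X i, Sup (slice K (X i)))) ` {..Suc k}"
  have slK: "\<exists>a b. a \<le> b \<and> slice K (X i) = {a..b}" for i
  proof -
    obtain a b where "slice K (X i) = {a..b}" using slice_eq_interval[OF K(1,2)] .
    moreover have "slice K (X i) \<noteq> {}" using X_in slice_ne by blast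
    ultimately show ?thesis by auto
  qed
  have "finite S" by (simp add: S_def)
  have "card S \<le> 2 * (k + 2)"
  proof -
    have c: "card (f ` {..Suc k}) \<le> k + 2" for f :: "nat \<Rightarrow> real^2"
      using card_image_le[of "{..Suc k}" f] by simp
    have "card S \<le> card ((\<lambda>i. vec2 (X i, Inf (slice K (X i)))) ` {..Suc k}) +
        card ((\<lambda>i. vec2 (X i, Sup (slice K (X i)))) ` {..Suc k})"
      unfolding S_def by (rule card_Un_le)
    also have "\<dots> \<le> (k + 2) + (k + 2)" by (intro add_mono c)
    finally show ?thesis by simp
  qed
  have "S \<subseteq> K"
  proof
    fix v assume "v \<in> S"
    then obtain i where i: "v = vec2 (X i, Inf (slice K (X i))) \<or> v = vec2 (X i, Sup (slice K (X i)))"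
      by (auto simp: S_def)
    obtain a b where "a \<le> b" "slice K (X i) = {a..b}" using slK by blast
    then have "Inf (slice K (X i)) \<in> slice K (X i)" "Sup (slice K (X i)) \<in> slice K (X i)" by auto
    then show "v \<in> K" using i by (auto simp: slice_def)
  qed
  define P where "P = convex hull S"
  have P: "compact P" "convex P" "P \<subseteq> K"
    unfolding P_def
    using finite_imp_compact_convex_hull[OF \<open>finite S\<close>] hull_minimal[OF \<open>S \<subseteq> K\<close>, of convex] K(2) by auto
  have P_sq: "P \<subseteq> unit_square" using P(3) K(3) by blast
  \<comment> \<open>Since P lies in K, the two sets thus have equal slices at the nodes: the hull
    contains the segment between the end points.\<close>
  have sub: "slice K (X i) \<subseteq> slice P (X i)" if "i \<le> Suc k" for i
  proof -
    obtain a b where e: "a \<le> b" "slice K (X i) = {a..b}" using slK by blast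
    have "vec2 (X i, Inf (slice K (X i))) \<in> S" "vec2 (X i, Sup (slice K (X i))) \<in> S"
      using that by (auto simp: S_def)
    then have "vec2 (X i, a) \<in> P" "vec2 (X i, b) \<in> P"
      using e hull_inc[of _ S convex] by (auto simp: P_def)
    then have "a \<in> slice P (X i)" "b \<in> slice P (X i)" by (auto simp: slice_def)
    then have "closed_segment a b \<subseteq> slice P (X i)"
      using convex_slice[OF P(2)] by (simp add: convex_contains_segment)
    then show ?thesis using e by (simp add: closed_segment_eq_real_ivl)
  qed
  have P_ne: "slice P (X i) \<noteq> {}" if "i \<le> Suc k" for i
    using sub[OF that] slice_ne[of "X i"] X_in[of i] by auto
  have intP: "integrable lborel (slice_length P)" "measure lborel P = (\<integral>x. slice_length P x \<partial>lborel)"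
    using area_eq_integral_slice_length[OF P(1) P_sq] .
  define l where "l i = slice_length K (X i)" for i
  have "sin h * (\<Sum>i<k. F (t + real i * h)) = (\<Sum>i<k. l (Suc i) * (2 * (r * sin (t + real i * h)) * sin h) / 2)"
    unfolding sum_distrib_left
  proof (rule sum.cong)
    fix i assume "i \<in> {..<k}"
    then have "X (Suc i) = c - r * cos (t + real i * h)" by (simp add: X_def)
    then show "sin h * F (t + real i * h) = l (Suc i) * (2 * (r * sin (t + real i * h)) * sin h) / 2"
      by (simp add: F_def l_def)
  qed simp
  also have "\<dots> \<le> (\<Sum>i<k. l (Suc i) * (X (Suc (Suc i)) - X i) / 2)"
    by (intro sum_mono divide_right_mono mult_left_mono X_diff) (auto simp: l_def)
  also have "\<dots> \<le> (\<Sum>i<Suc k. (X (Suc i) - X i) * (l i + l (Suc i)) / 2)"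
    by (rule trapezoid_sum_ge[of k X l, OF X_mono]) (auto simp: l_def)
  also have "\<dots> \<le> (\<Sum>i<Suc k. (X (Suc i) - X i) * (slice_length P (X i) + slice_length P (X (Suc i))) / 2)"
    unfolding l_def using X_mono
    by (intro sum_mono divide_right_mono mult_left_mono add_mono slice_length_mono[OF P(1) sub K(1)]) auto
  also have "\<dots> \<le> (\<Sum>i<Suc k. LINT x:{X i..X (Suc i)}|lborel. slice_length P x)"
  proof (intro sum_mono trapezoid_le_integral_slice_length P P_sq)
    fix i assume i: "i \<in> {..<Suc k}"
    show "slice P (X i) \<noteq> {}" "slice P (X (Suc i)) \<noteq> {}"
      using P_ne i by auto
    show "X i \<le> X (Suc i)" using X_mono i by simp
  qed
  also have "\<dots> = (LINT x:{X 0..X (Suc k)}|lborel. slice_length P x)"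
    using X_mono by (intro set_integral_partition[symmetric] set_integrable_lborelI intP) auto
  also have "\<dots> \<le> measure lborel P"
    unfolding intP(2) set_lebesgue_integral_def
    using integrable_mult_indicator[OF _ intP(1), of "{X 0..X (Suc k)}"]
    by (intro integral_mono intP) (auto simp: indicator_def)
  finally have ge: "sin h * (\<Sum>i<k. F (t + real i * h)) \<le> measure lborel P" .
  have "h \<le> pi" using h k by (simp add: h_def field_simps)
  then have "0 \<le> sin h" using h by (intro sin_ge_zero) auto
  \<comment> \<open>One \<open>h\<^sup>2\<close> was given up for the average; the other covers the
    loss in \<open>sin h / h \<ge> 1 - h\<^sup>2 / 6\<close>, because the area is at most 1.\<close>
  have "measure lborel K - measure lborel P \<le> 2 * h\<^sup>2"
  proof (cases "measure lborel K \<le> h\<^sup>2")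
    case True
    then show ?thesis using measure_nonneg[of lborel P] zero_le_power2[of h] by linarith
  next
    case False
    define A where "A = measure lborel K - h\<^sup>2"
    have A: "0 \<le> A" "A \<le> 1"
      unfolding A_def using False measure_le_1_unit_square[OF K(1,3)] zero_le_power2[of h] by linarith+
    have "A - h\<^sup>2 \<le> A - A * h\<^sup>2 / 6"
    proof -
      have "A * h\<^sup>2 \<le> 1 * h\<^sup>2" using A by (intro mult_right_mono) auto
      then show ?thesis using zero_le_power2[of h] by linarith
    qed
    also have "\<dots> = (h - h ^ 3 / 6) * (A / h)"
      using h by (simp add: field_simps power2_eq_square power3_eq_cube)
    also have "\<dots> \<le> sin h * (A / h)"
      using h A by (intro mult_right_mono sin_ge_cubic) auto
    also have "\<dots> \<le> sin h * (\<Sum>i<k. F (t + real i * h))"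
      using t_avg \<open>0 \<le> sin h\<close> by (intro mult_left_mono) (simp_all add: A_def)
    also have "\<dots> \<le> measure lborel P" by (rule ge)
    finally show ?thesis by (simp add: A_def)
  qed
  moreover have "S \<noteq> {}" by (simp add: S_def)
  ultimately show ?thesis
    using \<open>finite S\<close> \<open>card S \<le> 2 * (k + 2)\<close> \<open>S \<subseteq> K\<close> unfolding P_def h_def by blast
qed

section \<open>Moments\<close>

lemma unif2_eq_density: "unif2 = density lborel (indicator ({0..1} \<times> {0..1}))"
proof -
  have "unif2 = density (lborel \<Otimes>\<^sub>M lborel) (\<lambda>(x, y). indicator {0..1} x * indicator {0..1} y)"
    unfolding unif_def
    by (rule pair_measure_density)
       (auto intro: lborel.sigma_finite_measure_axioms unif.sigma_finite_measure_axioms[unfolded unif_def])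
  also have "(\<lambda>(x :: real, y :: real). indicator {0..1} x * indicator {0..1} y :: ennreal) = indicator ({0..1} \<times> {0..1})"
    by (auto simp: fun_eq_iff indicator_def)
  finally show ?thesis by (simp add: lborel_prod)
qed

lemma integral_unif2:
  fixes F :: "real \<times> real \<Rightarrow> real"
  assumes "F \<in> borel_measurable borel"
  shows "(\<integral>z. F z \<partial>unif2) = (\<integral>z. indicator ({0..1} \<times> {0..1}) z * F z \<partial>lborel)"
proof -
  have [measurable]: "{0..1} \<times> {0..1} \<in> sets (borel :: (real \<times> real) measure)"
    by (intro borel_closed closed_Times) auto
  show ?thesis
    unfolding unif2_eq_density
    using integral_density[of F lborel "indicator ({0..1} \<times> {0..1})"] assms
    by (simp add: ennreal_indicator[abs_def])
qed

lemma sets_unif2: "sets unif2 = sets borel"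
  unfolding unif2_eq_density by simp

lemma set_integral_eq_unif2:
  fixes G :: "real^2 \<Rightarrow> real"
  assumes C [measurable]: "C \<in> sets borel" and "C \<subseteq> unit_square" and [measurable]: "G \<in> borel_measurable borel"
  shows "(LINT v:C|lborel. G v) = (\<integral>z. indicator C (vec2 z) * G (vec2 z) \<partial>unif2)"
proof -
  have "(LINT v:C|lborel. G v) = (\<integral>v. indicator C v * G v \<partial>distr lborel borel vec2)"
    unfolding set_lebesgue_integral_def lborel_vec2 by simp
  also have "\<dots> = (\<integral>z. indicator C (vec2 z) * G (vec2 z) \<partial>lborel)"
    by (rule integral_distr) auto
  also have "\<dots> = (\<integral>z. indicator ({0..1} \<times> {0..1}) z * (indicator C (vec2 z) * G (vec2 z)) \<partial>lborel)"
  proof (rule Bochner_Integration.integral_cong)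
    fix z :: "real \<times> real"
    have "vec2 z \<in> C \<Longrightarrow> z \<in> {0..1} \<times> {0..1}"
      using assms(2) vec2_mem_unit_square[of "fst z" "snd z"] by (auto simp: mem_Times_iff)
    then show "indicator C (vec2 z) * G (vec2 z) = indicator ({0..1} \<times> {0..1}) z * (indicator C (vec2 z) * G (vec2 z))"
      by (auto simp: indicator_def)
  qed simp
  also have "\<dots> = (\<integral>z. indicator C (vec2 z) * G (vec2 z) \<partial>unif2)"
    by (rule integral_unif2[symmetric]) measurable
  finally show ?thesis .
qed

section \<open>Distances and moments of two convex sets as integrals over the unit square\<close>

definition diff_indicator :: "(real^2) set \<Rightarrow> (real^2) set \<Rightarrow> real \<times> real \<Rightarrow> real" where
  "diff_indicator K L z = indicator K (vec2 z) - indicator L (vec2 z)"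

lemma diff_indicator_bound: "\<bar>diff_indicator K L z\<bar> \<le> 1"
  by (auto simp: diff_indicator_def indicator_def)

context
  fixes K L :: "(real^2) set"
  assumes K: "compact K" "convex K" "K \<subseteq> unit_square" and L: "compact L" "convex L" "L \<subseteq> unit_square"
begin

lemma measurable_KL [measurable]: "K \<in> sets borel" "L \<in> sets borel"
  using K L by (auto intro: borel_compact)

lemma measurable_diff_indicator: "diff_indicator K L \<in> borel_measurable unif2"
proof -
  have "diff_indicator K L \<in> borel_measurable borel" unfolding diff_indicator_def by measurable
  then show ?thesis by (simp add: measurable_cong_sets[OF sets_unif2 refl])
qed

lemma sq_int_diff_indicator: "sq_int unif2 (diff_indicator K L)"
  by (intro sq_int_unif2[of _ 1] measurable_diff_indicator diff_indicator_bound)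

lemma set_integral_diff_eq_unif2:
  fixes G :: "real^2 \<Rightarrow> real"
  assumes [measurable]: "G \<in> borel_measurable borel" and B: "\<And>v. v \<in> unit_square \<Longrightarrow> \<bar>G v\<bar> \<le> B"
  shows "(LINT v:K|lborel. G v) - (LINT v:L|lborel. G v) = (\<integral>z. diff_indicator K L z * G (vec2 z) \<partial>unif2)"
proof -
  have "integrable unif2 (\<lambda>z. indicator C (vec2 z) * G (vec2 z))" if "C \<in> sets borel" for C
  proof (intro sq_int_unif2_imp_integrable sq_int_unif2[of _ B])
    have "(\<lambda>z. indicator C (vec2 z) * G (vec2 z)) \<in> borel_measurable borel"
      using that by measurable
    then show "(\<lambda>z. indicator C (vec2 z) * G (vec2 z)) \<in> borel_measurable unif2"
      by (simp add: measurable_cong_sets[OF sets_unif2 refl])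
    show "\<bar>indicator C (vec2 (x, y)) * G (vec2 (x, y))\<bar> \<le> B" if "x \<in> {0..1}" "y \<in> {0..1}" for x y
      using B[of "vec2 (x, y)"] that vec2_mem_unit_square[of x y] by (auto simp: indicator_def)
  qed
  then show ?thesis
    using K L by (simp add: set_integral_eq_unif2 diff_indicator_def left_diff_distrib)
qed

lemma nikodym_dist_eq_unif2: "nikodym_dist K L = (\<integral>z. (diff_indicator K L z)\<^sup>2 \<partial>unif2)"
proof -
  let ?C = "(K - L) \<union> (L - K)"
  have "nikodym_dist K L = (LINT v:?C|lborel. 1)"
    by (simp add: nikodym_dist_def set_lebesgue_integral_def)
  also have "\<dots> = (\<integral>z. indicator ?C (vec2 z) * 1 \<partial>unif2)"
    using K L by (intro set_integral_eq_unif2) auto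
  also have "\<dots> = (\<integral>z. (diff_indicator K L z)\<^sup>2 \<partial>unif2)"
    by (rule Bochner_Integration.integral_cong) (auto simp: diff_indicator_def indicator_def)
  finally show ?thesis .
qed

lemma legendre_moment_diff_eq:
  "legendre_moment i j K - legendre_moment i j L =
    (\<integral>z. diff_indicator K L z * (poly (legendre i) (fst z) * poly (legendre j) (snd z)) \<partial>unif2)"
proof -
  obtain B where B: "\<And>k x. k \<le> max i j \<Longrightarrow> x \<in> {0..1} \<Longrightarrow> \<bar>poly (legendre k) x\<bar> \<le> B"
    using legendre_bound by blast
  have "\<bar>poly (legendre i) (v $ 1) * poly (legendre j) (v $ 2)\<bar> \<le> B * B" if "v \<in> unit_square" for v :: "real^2"
    unfolding abs_mult using that B[of i "v $ 1"] B[of j "v $ 2"]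
    by (intro mult_mono) (auto simp: mem_box_cart forall_2)
  from set_integral_diff_eq_unif2[OF _ this] show ?thesis
    unfolding legendre_moment_def by simp
qed

lemma geometric_moment_diff_eq:
  "geometric_moment i j K - geometric_moment i j L =
    (\<integral>z. diff_indicator K L z * (fst z ^ i * snd z ^ j) \<partial>unif2)"
proof -
  have "\<bar>(v $ 1) ^ i * (v $ 2) ^ j\<bar> \<le> 1 * 1" if "v \<in> unit_square" for v :: "real^2"
    unfolding abs_mult using that
    by (intro mult_mono) (auto simp: mem_box_cart forall_2 power_abs power_le_one)
  from set_integral_diff_eq_unif2[OF _ this] show ?thesis
    unfolding geometric_moment_def by simp
qed

text \<open>Horizontal and vertical slices of both sets are intervals, so each variable adds at most
  16/(N + 1) to the tail.\<close>

lemma nikodym_dist_le_legendre_moments: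
  "nikodym_dist K L \<le> (\<Sum>i\<le>N. \<Sum>j\<le>N. (legendre_moment i j K - legendre_moment i j L)\<^sup>2) + 32 / (real N + 1)"
proof -
  have sl: "compact (slice C x)" "convex (slice C x)" "slice C x \<subseteq> {0..1}"
    "compact {y. vec2 (y, x) \<in> C}" "convex {y. vec2 (y, x) \<in> C}" "{y. vec2 (y, x) \<in> C} \<subseteq> {0..1}"
    if "compact C" "convex C" "C \<subseteq> unit_square" for C x
    using that compact_slice convex_slice slice_subset_unit
    unfolding horizontal_slice_eq_section by (auto intro!: compact_section convex_section simp: mem_box_cart forall_2)
  have "(\<integral>z. (diff_indicator K L z)\<^sup>2 \<partial>unif2) \<le>
    (\<Sum>i\<le>N. \<Sum>j\<le>N. (\<integral>z. diff_indicator K L z * (poly (legendre i) (fst z) * poly (legendre j) (snd z)) \<partial>unif2)\<^sup>2)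
      + 2 * (16 / (real N + 1))"
  proof (rule legendre_tail_2d[OF measurable_diff_indicator diff_indicator_bound])
    fix y :: real
    have "diff_indicator K L (x, y) = indicator {x. vec2 (x, y) \<in> K} x - indicator {x. vec2 (x, y) \<in> L} x" for x
      by (simp add: diff_indicator_def indicator_def)
    then show "(\<integral>x. (diff_indicator K L (x, y))\<^sup>2 \<partial>unif) -
        (\<Sum>i\<le>N. (\<integral>x. diff_indicator K L (x, y) * poly (legendre i) x \<partial>unif)\<^sup>2) \<le> 16 / (real N + 1)"
      using legendre_tail_indicators[OF sl(4-6)[OF K] sl(4-6)[OF L]] by simp
  next
    fix x :: real
    have "diff_indicator K L (x, y) = indicator (slice K x) y - indicator (slice L x) y" for y
      by (simp add: diff_indicator_def indicator_def slice_def)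
    then show "(\<integral>y. (diff_indicator K L (x, y))\<^sup>2 \<partial>unif) -
        (\<Sum>j\<le>N. (\<integral>y. diff_indicator K L (x, y) * poly (legendre j) y \<partial>unif)\<^sup>2) \<le> 16 / (real N + 1)"
      using legendre_tail_indicators[OF sl(1-3)[OF K] sl(1-3)[OF L]] by simp
  qed
  then show ?thesis by (simp add: nikodym_dist_eq_unif2 legendre_moment_diff_eq)
qed

end

section \<open>Bounds for moments by the norm\<close>

lemma integral_unif2_poly:
  "(\<integral>z. poly p (fst z) * poly q (snd z) \<partial>unif2) = (\<integral>x. poly p x \<partial>unif) * (\<integral>y. poly q y \<partial>unif)"
  and sq_int_unif2_poly: "sq_int unif2 (\<lambda>z. poly p (fst z) * poly q (snd z))"
proof -
  obtain B where B: "\<forall>x. 0 \<le> x \<longrightarrow> x \<le> 1 \<longrightarrow> \<bar>poly p x\<bar> \<le> B" using poly_bounded_unit by blast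
  obtain B' where B': "\<forall>x. 0 \<le> x \<longrightarrow> x \<le> 1 \<longrightarrow> \<bar>poly q x\<bar> \<le> B'" using poly_bounded_unit by blast
  have "B \<ge> 0" using B by (metis abs_ge_zero order_refl order_trans zero_le_one)
  show sq: "sq_int unif2 (\<lambda>z. poly p (fst z) * poly q (snd z))"
    using B B' \<open>B \<ge> 0\<close> by (intro sq_int_unif2[of _ "B * B'"]) (auto simp: abs_mult intro!: mult_mono)
  have "(\<integral>z. poly p (fst z) * poly q (snd z) \<partial>unif2) = (\<integral>x. \<integral>y. poly p x * poly q y \<partial>unif \<partial>unif)"
    using unif2.integral_fst'[OF sq_int_unif2_imp_integrable[OF sq]] by simp
  then show "(\<integral>z. poly p (fst z) * poly q (snd z) \<partial>unif2) = (\<integral>x. poly p x \<partial>unif) * (\<integral>y. poly q y \<partial>unif)"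
    by simp
qed

text \<open>Products of Legendre polynomials are orthonormal on the square because the integral
  factors, so Bessel's inequality applies.\<close>

lemma sum_legendre_coeffs_le:
  assumes "sq_int unif2 f"
  shows "(\<Sum>i\<le>N. \<Sum>j\<le>N. (\<integral>z. f z * (poly (legendre i) (fst z) * poly (legendre j) (snd z)) \<partial>unif2)\<^sup>2)
    \<le> (\<integral>z. (f z)\<^sup>2 \<partial>unif2)"
proof -
  let ?\<phi> = "\<lambda>(i, j) z. poly (legendre i) (fst z) * poly (legendre j) (snd z)"
  have "(\<Sum>p\<in>{..N}\<times>{..N}. (\<integral>z. f z * ?\<phi> p z \<partial>unif2)\<^sup>2) \<le> (\<integral>z. (f z)\<^sup>2 \<partial>unif2)"
  proof (rule bessel_inequality[OF _ _ assms])
    show "sq_int unif2 (?\<phi> p)" for p by (cases p) (simp add: sq_int_unif2_poly)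
    show "(\<integral>z. ?\<phi> p z * ?\<phi> q z \<partial>unif2) = (if p = q then 1 else 0)" for p q
    proof (cases p; cases q)
      fix i j k l assume pq: "p = (i, j)" "q = (k, l)"
      have "(\<integral>z. ?\<phi> p z * ?\<phi> q z \<partial>unif2) =
          (\<integral>z. poly (legendre i * legendre k) (fst z) * poly (legendre j * legendre l) (snd z) \<partial>unif2)"
        by (simp add: pq mult_ac)
      also have "\<dots> = (if p = q then 1 else 0)"
      proof -
        have "(\<integral>x. poly (legendre i * legendre j) x \<partial>unif) = (if i = j then 1 else 0)" for i j
          by (simp add: legendre_orthonormal)
        then show ?thesis unfolding integral_unif2_poly pq by (simp only:) simp
      qed
      finally show ?thesis .
    qed
  qed simp
  then show ?thesis by (simp add: sum.cartesian_product split_def)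
qed

text \<open>By duality the estimate is equivalent to boundedness of the Hilbert matrix, the Gram matrix of
  the monomials.\<close>

lemma sum_moments_squared_le:
  assumes f: "sq_int unif2 f"
  shows "(\<Sum>i\<le>N. \<Sum>j\<le>N. (\<integral>z. f z * (fst z ^ i * snd z ^ j) \<partial>unif2)\<^sup>2) \<le> 16 * (\<integral>z. (f z)\<^sup>2 \<partial>unif2)"
proof -
  let ?I = "{..N} \<times> {..N}"
  define a where "a i j = (\<integral>z. f z * (fst z ^ i * snd z ^ j) \<partial>unif2)" for i j
  define e where "e x z = fst z ^ fst x * snd z ^ snd x" for x :: "nat \<times> nat" and z :: "real \<times> real"
  define S where "S = (\<Sum>(i,j)\<in>?I. (a i j)\<^sup>2)"
  \<comment> \<open>The dual polynomial: its coefficients are the moments themselves, so its inner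
    product with \<open>f\<close> is S, while its squared norm is the Hilbert form.\<close>
  define p where "p z = (\<Sum>x\<in>?I. case_prod a x * e x z)" for z
  have e_poly: "e x z = poly (monom 1 (fst x)) (fst z) * poly (monom 1 (snd x)) (snd z)" for x z
    by (simp add: e_def poly_monom)
  have e2: "sq_int unif2 (e x)" for x
    unfolding e_poly[abs_def] by (rule sq_int_unif2_poly)
  have p2: "sq_int unif2 p"
    unfolding p_def by (intro sq_int_sum sq_int_scale e2)
  have mono: "(\<integral>x. x ^ m \<partial>unif) = 1 / (real m + 1)" for m
  proof -
    have "(\<integral>x. x ^ m \<partial>unif) = (LINT x:{0..1}|lborel. x ^ m)" by (rule integral_unif) measurable
    also have "\<dots> = 1 ^ Suc m / (real m + 1) - 0 ^ Suc m / (real m + 1)"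
    proof -
      have "((\<lambda>x. x ^ Suc m / (real m + 1)) has_real_derivative x ^ m) (at x within {0..1})" for x :: real
      proof -
        have "((\<lambda>x. x ^ Suc m / (real m + 1)) has_real_derivative (real (Suc m) * x ^ m) / (real m + 1)) (at x within {0..1})"
          by (rule derivative_eq_intros refl | simp)+
        moreover have "(real (Suc m) * x ^ m) / (real m + 1) = x ^ m" by (simp add: add.commute)
        ultimately show ?thesis by (simp only:)
      qed
      then show ?thesis
        unfolding set_lebesgue_integral_def has_real_derivative_iff_has_vector_derivative
        by (intro integral_FTC_Icc[of 0 1 "\<lambda>x. x ^ Suc m / (real m + 1)"] continuous_intros) auto
    qed
    finally show ?thesis by simp
  qed
  have ee: "(\<integral>z. e x z * e y z \<partial>unif2) = 1 / ((real (fst x) + real (fst y) + 1) * (real (snd x) + real (snd y) + 1))" for x y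
  proof -
    have "(\<integral>z. e x z * e y z \<partial>unif2) =
        (\<integral>z. poly (monom 1 (fst x + fst y)) (fst z) * poly (monom 1 (snd x + snd y)) (snd z) \<partial>unif2)"
      by (simp add: e_def poly_monom power_add mult_ac)
    also have "\<dots> = (\<integral>t. t ^ (fst x + fst y) \<partial>unif) * (\<integral>t. t ^ (snd x + snd y) \<partial>unif)"
    proof -
      have "poly (monom 1 m) = (\<lambda>t :: real. t ^ m)" for m by (simp add: poly_monom fun_eq_iff)
      then show ?thesis unfolding integral_unif2_poly by simp
    qed
    finally show ?thesis by (simp add: mono)
  qed
  have pp: "(\<integral>z. (p z)\<^sup>2 \<partial>unif2) \<le> 16 * S"
  proof -
    have "(\<integral>z. (p z)\<^sup>2 \<partial>unif2) = (\<integral>z. (\<Sum>x\<in>?I. \<Sum>y\<in>?I. (case_prod a x * case_prod a y) * (e x z * e y z)) \<partial>unif2)"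
      by (simp add: p_def power2_eq_square sum_product mult_ac)
    also have "\<dots> = (\<Sum>x\<in>?I. \<Sum>y\<in>?I. (case_prod a x * case_prod a y) * (\<integral>z. e x z * e y z \<partial>unif2))"
      using sq_int_mult_integrable[OF e2 e2]
      by (subst Bochner_Integration.integral_sum; (intro Bochner_Integration.integrable_sum)?; simp)+
    also have "\<dots> = (\<Sum>(i,j)\<in>?I. \<Sum>(k,l)\<in>?I. a i j * a k l * (1 / ((real i + real k + 1) * (real j + real l + 1))))"
      by (simp add: ee split_def)
    also have "\<dots> \<le> 16 * S" unfolding S_def by (rule hilbert_form_2d)
    finally show ?thesis .
  qed
  have "S = (\<Sum>x\<in>?I. case_prod a x * (\<integral>z. f z * e x z \<partial>unif2))"
    by (simp add: S_def e_def a_def split_def power2_eq_square)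
  also have "\<dots> = (\<integral>z. f z * p z \<partial>unif2)"
  proof -
    have "(\<integral>z. f z * p z \<partial>unif2) = (\<integral>z. (\<Sum>x\<in>?I. case_prod a x * (f z * e x z)) \<partial>unif2)"
      by (simp add: p_def sum_distrib_left mult_ac)
    also have "\<dots> = (\<Sum>x\<in>?I. case_prod a x * (\<integral>z. f z * e x z \<partial>unif2))"
      using sq_int_mult_integrable[OF f e2] by (subst Bochner_Integration.integral_sum) auto
    finally show ?thesis by simp
  qed
  \<comment> \<open>The weights are chosen so that the first term is at most 16 * S / 32 = S / 2 and
    can be absorbed on the left.\<close>
  also have "\<dots> \<le> (\<integral>z. (p z)\<^sup>2 / 32 + 8 * (f z)\<^sup>2 \<partial>unif2)"
  proof (rule integral_mono)
    show "f z * p z \<le> (p z)\<^sup>2 / 32 + 8 * (f z)\<^sup>2" for z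
      using sum_squares_bound[of "p z" "16 * f z"] by (simp add: power_mult_distrib field_simps)
  qed (use f p2 sq_int_mult_integrable[OF f p2] in \<open>auto simp: sq_int_def\<close>)
  also have "\<dots> = (\<integral>z. (p z)\<^sup>2 \<partial>unif2) / 32 + 8 * (\<integral>z. (f z)\<^sup>2 \<partial>unif2)"
    using f p2 by (simp add: sq_int_def)
  finally have "S \<le> 16 * (\<integral>z. (f z)\<^sup>2 \<partial>unif2)" using pp by linarith
  then show ?thesis by (simp add: S_def a_def sum.cartesian_product split_def)
qed

section \<open>From geometric to Legendre moments\<close>

lemma poly_eq_sum_coeff_atMost:
  fixes p :: "real poly"
  shows "degree p \<le> n \<Longrightarrow> poly p x = (\<Sum>k\<le>n. coeff p k * x ^ k)"
  unfolding poly_altdef by (rule sum.mono_neutral_left) (auto simp: coeff_eq_0)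

text \<open>Both Legendre polynomials are expanded in powers, and Cauchy-Schwarz is applied for each
  of the (n + 1)^2 index pairs. Together with the two factors W this gives the exponent 8 = 2 + 3 +
  3 and the base 4096 = 64 * 64.\<close>

lemma legendre_coeffs_le_moments:
  assumes f: "sq_int unif2 f"
  defines "\<mu> \<equiv> \<lambda>i j. \<integral>z. f z * (fst z ^ i * snd z ^ j) \<partial>unif2"
  shows "(\<Sum>i\<le>n. \<Sum>j\<le>n. (\<integral>z. f z * (poly (legendre i) (fst z) * poly (legendre j) (snd z)) \<partial>unif2)\<^sup>2)
    \<le> (real n + 1) ^ 8 * 4096 ^ (n + 1) * (\<Sum>i\<le>n. \<Sum>j\<le>n. (\<mu> i j)\<^sup>2)"
proof -
  let ?I = "{..n} \<times> {..n}"
  define M where "M = (\<Sum>i\<le>n. \<Sum>j\<le>n. (\<mu> i j)\<^sup>2)"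
  define W where "W = (real n + 1) ^ 3 * 64 ^ (n + 1)"
  have int: "integrable unif2 (\<lambda>z. f z * (fst z ^ k * snd z ^ l))" for k l
    using sq_int_mult_integrable[OF f sq_int_unif2_poly[of "monom 1 k" "monom 1 l"]] by (simp add: poly_monom)
  have "(\<integral>z. f z * (poly (legendre i) (fst z) * poly (legendre j) (snd z)) \<partial>unif2)\<^sup>2 \<le> W * W * M"
    if ij: "i \<le> n" "j \<le> n" for i j
  proof -
    let ?c = "\<lambda>(k, l). coeff (legendre i) k * coeff (legendre j) l"
    have "f z * (poly (legendre i) (fst z) * poly (legendre j) (snd z)) =
        (\<Sum>x\<in>?I. ?c x * (f z * (fst z ^ fst x * snd z ^ snd x)))" for z
    proof -
      have "poly (legendre i) (fst z) * poly (legendre j) (snd z) =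
          (\<Sum>x\<in>?I. ?c x * (fst z ^ fst x * snd z ^ snd x))"
        using ij by (simp add: poly_eq_sum_coeff_atMost[of _ n] degree_legendre sum_product sum.cartesian_product split_def mult_ac)
      then show ?thesis by (simp add: sum_distrib_left mult_ac)
    qed
    then have "(\<integral>z. f z * (poly (legendre i) (fst z) * poly (legendre j) (snd z)) \<partial>unif2) =
        (\<Sum>x\<in>?I. ?c x * case_prod \<mu> x)"
      using int by (simp add: Bochner_Integration.integral_sum \<mu>_def split_def)
    then have "(\<integral>z. f z * (poly (legendre i) (fst z) * poly (legendre j) (snd z)) \<partial>unif2)\<^sup>2 \<le>
        (\<Sum>x\<in>?I. (?c x)\<^sup>2) * (\<Sum>x\<in>?I. (case_prod \<mu> x)\<^sup>2)"
      by (simp only: Cauchy_Schwarz_ineq_sum)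
    also have "(\<Sum>x\<in>?I. (?c x)\<^sup>2) = (\<Sum>k\<le>n. (coeff (legendre i) k)\<^sup>2) * (\<Sum>l\<le>n. (coeff (legendre j) l)\<^sup>2)"
      by (simp add: sum_product sum.cartesian_product split_def power_mult_distrib)
    also have "(\<Sum>x\<in>?I. (case_prod \<mu> x)\<^sup>2) = M"
      by (simp add: M_def sum.cartesian_product split_def)
    also have "(\<Sum>k\<le>n. (coeff (legendre i) k)\<^sup>2) * (\<Sum>l\<le>n. (coeff (legendre j) l)\<^sup>2) * M \<le> W * W * M"
      unfolding W_def M_def using ij
      by (intro mult_right_mono mult_mono sum_coeff_legendre_squared_le sum_nonneg) auto
    finally show ?thesis .
  qed
  then have "(\<Sum>i\<le>n. \<Sum>j\<le>n. (\<integral>z. f z * (poly (legendre i) (fst z) * poly (legendre j) (snd z)) \<partial>unif2)\<^sup>2)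
    \<le> (\<Sum>i\<le>n. \<Sum>j\<le>n. W * W * M)"
    by (intro sum_mono) auto
  also have "\<dots> = (real n + 1)\<^sup>2 * (W * W) * M" by (simp add: power2_eq_square add.commute)
  also have "(real n + 1)\<^sup>2 * (W * W) = (real n + 1) ^ 8 * 4096 ^ (n + 1)"
  proof -
    have "(64 :: real) ^ (n + 1) * 64 ^ (n + 1) = 4096 ^ (n + 1)" by (simp flip: power_mult_distrib)
    moreover have "(real n + 1)\<^sup>2 * (W * W) = (real n + 1)\<^sup>2 * ((real n + 1) ^ 3 * (real n + 1) ^ 3) * (64 ^ (n + 1) * 64 ^ (n + 1))"
      unfolding W_def by (simp only: mult_ac)
    moreover have "(real n + 1)\<^sup>2 * ((real n + 1) ^ 3 * (real n + 1) ^ 3) = (real n + 1) ^ 8"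
      by (simp flip: power_add)
    ultimately show ?thesis by simp
  qed
  finally show ?thesis by (simp add: M_def)
qed

text \<open>As p + 1 \<le> 2^(p + 1), the left side is at most 2^(20 (p + 1)), hence at most exp (20
  (p + 1)). With p \<le> n/4 the exponent is at most 5 n + 20, below 7 (n + 1) + 21.\<close>

lemma polynomial_times_exponential_le:
  fixes n p :: nat
  assumes "p = n div 4"
  shows "(real p + 1) ^ 8 * 4096 ^ (p + 1) \<le> exp 21 * exp (7 * (real n + 1))"
proof -
  have "real p + 1 \<le> 2 ^ (p + 1)"
    using of_nat_less_two_power[of "p + 1", where 'a = real] by simp
  then have "(real p + 1) ^ 8 \<le> (2 ^ (p + 1)) ^ 8" by (rule power_mono) simp
  also have "\<dots> = (2 ^ 8) ^ (p + 1)" by (simp only: power_mult[symmetric] mult.commute)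
  finally have "(real p + 1) ^ 8 * 4096 ^ (p + 1) \<le> (2 ^ 8) ^ (p + 1) * 4096 ^ (p + 1)" by simp
  also have "\<dots> = (2 ^ 8 * 2 ^ 12) ^ (p + 1)" unfolding power_mult_distrib by simp
  also have "\<dots> = 2 ^ (20 * (p + 1))" by (simp only: power_mult power_add[symmetric]) simp
  also have "\<dots> \<le> exp 1 ^ (20 * (p + 1))"
    using exp_ge_add_one_self[of 1] by (intro power_mono) auto
  also have "\<dots> = exp (20 * (real p + 1))" by (simp flip: exp_of_nat_mult)
  also have "\<dots> \<le> exp (21 + 7 * (real n + 1))"
    using assms by simp
  finally show ?thesis by (simp only: exp_add)
qed

text \<open>For m \<le> 16 a single point suffices: the constant is at least 256 = 16 * 16, so the
  bound is at least 1. For larger m the inscribed polygon with m \<le> 3 k has deficit at most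
  \<open>2 * (3 * pi / m)\<^sup>2\<close>, and the constant also dominates
  \<open>18 * pi\<^sup>2\<close>.\<close>

lemma exists_inscribed_polygon:
  assumes K: "compact K" "convex K" "K \<subseteq> unit_square" "K \<noteq> {}" and m: "m \<ge> 3"
  shows "\<exists>P\<in>convex_polygons m. nikodym_dist K P \<le> (8 * pi ^ 3 + 16 * pi) / (real m)\<^sup>2"
proof -
  have hull: "convex hull S \<in> convex_polygons m"
    "nikodym_dist K (convex hull S) = measure lborel K - measure lborel (convex hull S)"
    if S: "finite S" "card S \<le> m" "S \<noteq> {}" "S \<subseteq> K" for S
  proof -
    have sub: "convex hull S \<subseteq> K" using hull_minimal[OF S(4), of convex] K(2) by simp
    have "{v. v extreme_point_of convex hull S} \<subseteq> S" using extreme_point_of_convex_hull by blast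
    then have "card {v. v extreme_point_of convex hull S} \<le> m"
      using card_mono[OF S(1)] S(2) by (meson order_trans)
    then show "convex hull S \<in> convex_polygons m"
      using S sub K(3) by (auto simp: convex_polygons_def polytope_def)
    have "(K - convex hull S) \<union> (convex hull S - K) = K - convex hull S" using sub by blast
    then show "nikodym_dist K (convex hull S) = measure lborel K - measure lborel (convex hull S)"
      unfolding nikodym_dist_def
      using measurable_measure_Diff[of K lborel "convex hull S"] sub
        fmeasurable_compact[OF K(1)] fmeasurable_compact[OF finite_imp_compact_convex_hull[OF S(1)]]
        borel_compact[OF finite_imp_compact_convex_hull[OF S(1)]]
      by simp
  qed
  have pi3: "3 < pi" by (rule pi_gt3)
  have c: "8 * pi ^ 3 + 16 * pi \<ge> 256" "8 * pi ^ 3 + 16 * pi \<ge> 18 * pi\<^sup>2"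
  proof -
    have "pi * pi \<ge> 3 * pi" using pi3 by (intro mult_right_mono) auto
    then have p2: "pi * pi \<ge> 9" "8 * (pi * pi) + 16 \<ge> 18 * pi" using pi3 by linarith+
    have "pi * (8 * (pi * pi) + 16) \<ge> pi * (18 * pi)" using p2(2) by (intro mult_left_mono) auto
    then show "8 * pi ^ 3 + 16 * pi \<ge> 18 * pi\<^sup>2"
      by (simp add: power3_eq_cube power2_eq_square algebra_simps)
    have "pi * (8 * (pi * pi) + 16) \<ge> 3 * (8 * 9 + 16)" using p2(1) pi3 by (intro mult_mono) auto
    then show "8 * pi ^ 3 + 16 * pi \<ge> 256"
      by (simp add: power3_eq_cube algebra_simps)
  qed
  show ?thesis
  proof (cases "m \<le> 16")
    case True
    obtain v where v: "v \<in> K" using K(4) by blast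
    have "nikodym_dist K (convex hull {v}) = measure lborel K - measure lborel (convex hull {v})"
      using v m by (intro hull(2)) auto
    also have "\<dots> \<le> 1"
      using measure_le_1_unit_square[OF K(1,3)] measure_nonneg[of lborel "convex hull {v}"] by linarith
    also have "\<dots> \<le> (8 * pi ^ 3 + 16 * pi) / (real m)\<^sup>2"
    proof -
      have "(real m)\<^sup>2 \<le> 16\<^sup>2" using True by (intro power_mono) auto
      then have "(real m)\<^sup>2 \<le> 8 * pi ^ 3 + 16 * pi" using c(1) by simp
      then show ?thesis using m by (simp add: pos_le_divide_eq)
    qed
    finally show ?thesis using hull(1)[of "{v}"] v m by auto
  next
    case False
    \<comment> \<open>The largest k whose 2 * (k + 2) vertices are admissible; the bound m \<le> 3 k
      below needs m to be large enough.\<close>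
    define k where "k = m div 2 - 2"
    have k: "k \<ge> 1" "2 * (k + 2) \<le> m" "real m \<le> 3 * real k" using False by (auto simp: k_def)
    obtain S where S: "finite S" "card S \<le> 2 * (k + 2)" "S \<noteq> {}" "S \<subseteq> K"
      "measure lborel K - measure lborel (convex hull S) \<le> 2 * (pi / real k)\<^sup>2"
      using inscribed_polygon[OF K k(1)] by blast
    have Sm: "card S \<le> m" using S(2) k(2) by linarith
    have "nikodym_dist K (convex hull S) \<le> 2 * (pi / real k)\<^sup>2"
      using S(5) hull(2)[OF S(1) Sm S(3,4)] by simp
    also have "\<dots> \<le> 2 * (pi / (real m / 3))\<^sup>2"
      using k m by (intro mult_left_mono power_mono divide_left_mono) auto
    also have "\<dots> = 18 * pi\<^sup>2 / (real m)\<^sup>2" by (simp add: power_divide power_mult_distrib)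
    also have "\<dots> \<le> (8 * pi ^ 3 + 16 * pi) / (real m)\<^sup>2" using c(2) by (intro divide_right_mono) auto
    finally show ?thesis using hull(1)[OF S(1) Sm S(3,4)] by blast
  qed
qed

section \<open>Assembly of the two error bounds\<close>

lemma nikodym_dist_commute: "nikodym_dist K L = nikodym_dist L K"
  by (simp add: nikodym_dist_def Un_commute)

lemma convex_polygonsD:
  assumes "P \<in> convex_polygons m"
  shows "compact P" "convex P" "P \<subseteq> unit_square"
  using assms by (auto simp: convex_polygons_def polytope_imp_compact polytope_imp_convex)

lemma least_squares_estimatorD:
  assumes "least_squares_estimator moment N m K P"
  shows "P \<in> convex_polygons m"
    "Q \<in> convex_polygons m \<Longrightarrow>
      (\<Sum>i\<le>N. \<Sum>j\<le>N. (moment i j K - moment i j P)\<^sup>2) \<le> (\<Sum>i\<le>N. \<Sum>j\<le>N. (moment i j K - moment i j Q)\<^sup>2)"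
  using assms by (auto simp: least_squares_estimator_def is_arg_min_linorder)

theorem theorem5p1:
  shows "\<exists>a0>0. \<exists>a1>0. \<forall>(K :: (real^2) set) (N :: nat) (m :: nat).
    convex_body K \<longrightarrow> K \<subseteq> unit_square \<longrightarrow> 3 \<le> m \<longrightarrow>
      (\<forall>P. least_squares_estimator geometric_moment N m K P \<longrightarrow>
        (\<forall>n\<le>N. nikodym_dist P K \<le>
            a0 * (real n + 1)\<^sup>2 * exp (7 * (real n + 1)) * (1 + 1/2 * ln (2 * real n + 1))\<^sup>2 *
              ((8 * pi ^ 3 + 16 * pi) / (real m)\<^sup>2) + a1 / (real n + 1))) \<and>
      (\<forall>Q. least_squares_estimator legendre_moment N m K Q \<longrightarrow>
        nikodym_dist Q K \<le> (8 * pi ^ 3 + 16 * pi) / (real m)\<^sup>2 + a1 / (real N + 1))"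
\<comment> \<open>16 is the bound of the Hilbert form and \<open>exp 21\<close> comes from
  \<open>polynomial_times_exponential_le\<close>; 128 = 4 * 32, because n + 1 \<le> 4 (p + 1) for
  \<open>p = n div 4\<close>.\<close>
proof (rule exI[of _ "16 * exp 21"], rule conjI, simp, rule exI[of _ 128], rule conjI, simp,
    intro conjI allI impI)
  fix K :: "(real^2) set" and N m :: nat
  assume "convex_body K" and sq: "K \<subseteq> unit_square" and m: "3 \<le> m"
  then have K: "compact K" "convex K" "K \<subseteq> unit_square" "K \<noteq> {}"
    by (auto simp: convex_body_def)
  define C where "C = (8 * pi ^ 3 + 16 * pi) / (real m)\<^sup>2"
  have C: "C \<ge> 0" by (simp add: C_def)
  obtain A where A: "A \<in> convex_polygons m" and KA: "nikodym_dist K A \<le> C"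
    using exists_inscribed_polygon[OF K m] by (auto simp: C_def)
  note A' = convex_polygonsD[OF A]
  {
    fix P assume lse: "least_squares_estimator geometric_moment N m K P"
    fix n assume n: "n \<le> N"
    note P = convex_polygonsD[OF least_squares_estimatorD(1)[OF lse]]
    define p where "p = n div 4"
    define B where "B = (real p + 1) ^ 8 * 4096 ^ (p + 1)"
    have B: "B \<ge> 0" by (simp add: B_def)
    have "nikodym_dist P K = nikodym_dist K P" by (rule nikodym_dist_commute)
    also have "\<dots> \<le> (\<Sum>i\<le>p. \<Sum>j\<le>p. (legendre_moment i j K - legendre_moment i j P)\<^sup>2) + 32 / (real p + 1)"
      by (rule nikodym_dist_le_legendre_moments[OF K(1-3) P])
    also have "(\<Sum>i\<le>p. \<Sum>j\<le>p. (legendre_moment i j K - legendre_moment i j P)\<^sup>2) \<le>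
        B * (\<Sum>i\<le>p. \<Sum>j\<le>p. (geometric_moment i j K - geometric_moment i j P)\<^sup>2)"
      unfolding legendre_moment_diff_eq[OF K(1-3) P] geometric_moment_diff_eq[OF K(1-3) P] B_def
      by (rule legendre_coeffs_le_moments[OF sq_int_diff_indicator[OF K(1-3) P]])
    \<comment> \<open>Since p \<le> n \<le> N, the moments up to degree p are among those that the
      estimator fits.\<close>
    also have "(\<Sum>i\<le>p. \<Sum>j\<le>p. (geometric_moment i j K - geometric_moment i j P)\<^sup>2) \<le>
        (\<Sum>i\<le>N. \<Sum>j\<le>p. (geometric_moment i j K - geometric_moment i j P)\<^sup>2)"
      using n by (intro sum_mono2 sum_nonneg) (auto simp: p_def)
    also have "\<dots> \<le> (\<Sum>i\<le>N. \<Sum>j\<le>N. (geometric_moment i j K - geometric_moment i j P)\<^sup>2)"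
      using n by (intro sum_mono sum_mono2) (auto simp: p_def)
    also have "\<dots> \<le> (\<Sum>i\<le>N. \<Sum>j\<le>N. (geometric_moment i j K - geometric_moment i j A)\<^sup>2)"
      by (rule least_squares_estimatorD(2)[OF lse A])
    also have "\<dots> \<le> 16 * nikodym_dist K A"
      unfolding geometric_moment_diff_eq[OF K(1-3) A'] nikodym_dist_eq_unif2[OF K(1-3) A']
      by (rule sum_moments_squared_le[OF sq_int_diff_indicator[OF K(1-3) A']])
    also have "\<dots> \<le> 16 * C" using KA by simp
    finally have "nikodym_dist P K \<le> B * (16 * C) + 32 / (real p + 1)"
      using B by (simp add: mult_left_mono)
    also have "\<dots> \<le> (exp 21 * exp (7 * (real n + 1))) * (16 * C) + 128 / (real n + 1)"
    proof (rule add_mono)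
      show "B * (16 * C) \<le> (exp 21 * exp (7 * (real n + 1))) * (16 * C)"
        unfolding B_def using C by (intro mult_right_mono polynomial_times_exponential_le p_def) auto
      have "real n + 1 \<le> 4 * (real p + 1)" by (simp add: p_def)
      then show "32 / (real p + 1) \<le> 128 / (real n + 1)" by (simp add: divide_simps)
    qed
    \<comment> \<open>The inserted factors are at least 1, the logarithm of \<open>2 * n + 1\<close>
      being nonnegative.\<close>
    also have "(exp 21 * exp (7 * (real n + 1))) * (16 * C) \<le>
        (exp 21 * exp (7 * (real n + 1))) * (16 * C) * ((real n + 1)\<^sup>2 * (1 + 1/2 * ln (2 * real n + 1))\<^sup>2)"
    proof -
      have "1 * 1 \<le> (real n + 1)\<^sup>2 * (1 + 1/2 * ln (2 * real n + 1))\<^sup>2"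
        by (intro mult_mono one_le_power) auto
      moreover have "0 \<le> (exp 21 * exp (7 * (real n + 1))) * (16 * C)" using C by simp
      ultimately have "(exp 21 * exp (7 * (real n + 1))) * (16 * C) * (1 * 1) \<le>
          (exp 21 * exp (7 * (real n + 1))) * (16 * C) * ((real n + 1)\<^sup>2 * (1 + 1/2 * ln (2 * real n + 1))\<^sup>2)"
        by (rule mult_left_mono)
      then show ?thesis by (simp only: mult_1_right)
    qed
    finally show "nikodym_dist P K \<le> 16 * exp 21 * (real n + 1)\<^sup>2 * exp (7 * (real n + 1)) *
        (1 + 1/2 * ln (2 * real n + 1))\<^sup>2 * ((8 * pi ^ 3 + 16 * pi) / (real m)\<^sup>2) + 128 / (real n + 1)"
      unfolding C_def[symmetric] by (simp add: mult_ac)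
  }
  {
    fix Q assume lse: "least_squares_estimator legendre_moment N m K Q"
    note Q = convex_polygonsD[OF least_squares_estimatorD(1)[OF lse]]
    have "nikodym_dist Q K = nikodym_dist K Q" by (rule nikodym_dist_commute)
    also have "\<dots> \<le> (\<Sum>i\<le>N. \<Sum>j\<le>N. (legendre_moment i j K - legendre_moment i j Q)\<^sup>2) + 32 / (real N + 1)"
      by (rule nikodym_dist_le_legendre_moments[OF K(1-3) Q])
    also have "(\<Sum>i\<le>N. \<Sum>j\<le>N. (legendre_moment i j K - legendre_moment i j Q)\<^sup>2) \<le>
        (\<Sum>i\<le>N. \<Sum>j\<le>N. (legendre_moment i j K - legendre_moment i j A)\<^sup>2)"
      by (rule least_squares_estimatorD(2)[OF lse A])
    also have "\<dots> \<le> nikodym_dist K A"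
      unfolding legendre_moment_diff_eq[OF K(1-3) A'] nikodym_dist_eq_unif2[OF K(1-3) A']
      by (rule sum_legendre_coeffs_le[OF sq_int_diff_indicator[OF K(1-3) A']])
    also have "\<dots> \<le> C" by (rule KA)
    also have "32 / (real N + 1) \<le> 128 / (real N + 1)" by (rule divide_right_mono) auto
    finally show "nikodym_dist Q K \<le> (8 * pi ^ 3 + 16 * pi) / (real m)\<^sup>2 + 128 / (real N + 1)"
      by (simp add: C_def)
  }
qed

end
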